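(* Let $Q^\sigma$ be a signed quiver with associated symmetric quiver $\widetilde{Q}$, and let $V$ be an indecomposable symmetric representation of $\widetilde{Q}$. Then, as a representation of the quiver $\widetilde{Q}$, either $V$ is indecomposable, or $V\cong W\oplus W^*$ for some indecomposable representation $W$ of $\widetilde{Q}$.
   Context: $\mathbf{k}$ is an algebraically closed field of characteristic $0$; vector spaces are finite-dimensional. A quiver $Q$ is a finite oriented graph with vertex set $Q_0$ and arrow set $Q_1$; $t\varphi,h\varphi$ are the tail and head of an arrow $\varphi$. A representation $V$ assigns a $\mathbf{k}$-space $V(i)$ to each vertex and a linear map $V(\varphi):V(t\varphi)\to V(h\varphi)$ to each arrow. Signed quiver: a signed quiver $Q^\sigma$ is a quiver $Q$ with a function $\sigma:Q_0\sqcup Q_1\to\{-1,0,1\}$ and a choice of $m\ge 0$ disjoint pairs $\{i,i^*\}$ of distinct vertices, called twins. A vertex or arrow is called signed if its $\sigma$ is nonzero, unsigned otherwise. Axioms: (1) twins are unsigned; (2) a non-loop arrow is signed iff its two endpoints are twins of each other; (3) a loop is signed iff its vertex is signed. Associated symmetric quiver $\widetilde{Q}$: add to $Q$ a new vertex $j^*$ for each unsigned vertex $j$ that is not in a twin pair, and a new arrow $\varphi^*:(h\varphi)^*\to(t\varphi)^*$ for each unsigned arrow $\varphi$ of $Q$. The involution $*$ on $\widetilde{Q}_0$ and $\widetilde{Q}_1$ exchanges $i\leftrightarrow i^*$ and $\varphi\leftrightarrow\varphi^*$ and fixes signed vertices and signed arrows; new vertices and arrows have $\sigma=0$. Dual representation: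 for $\varphi\in\widetilde{Q}_1$ let $s_\varphi=-1$ if exactly one of $\sigma(\varphi)=-1$, $\sigma(h\varphi)=-1$ holds, and $s_\varphi=1$ otherwise. For a representation $V$ of $\widetilde{Q}$, $V^*(i)=(V(i^* ))^*$ and $V^*(\varphi)=s_\varphi V(\varphi^* )^*$. A signed form on spaces $V(i)$ ($i\in\widetilde{Q}_0$) is a collection of isomorphisms $J_i:V(i)\to(V(i^* ))^*$ with $J_{i^*}=(J_i)^*$ if $i\ne i^*$ and $(J_i)^*=\sigma(i)J_i$ if $i=i^*$. A representation $V$ of $\widetilde{Q}$ is symmetric with respect to a signed form $J$ if $(J_i)$ is an isomorphism of representations $V\to V^*$. The direct sum of symmetric representations is symmetric with respect to the direct sum of the forms. A nonzero symmetric representation is called indecomposable (as a symmetric representation) if it is not isomorphic to a direct sum of two nonzero symmetric representations. *)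

theory Defs
  imports
    "Graph_Theory.Digraph"
    "HOL-Computational_Algebra.Polynomial"
    "HOL-Library.Function_Algebras"
    "HOL-Analysis.Product_Vector"
begin

section \<open>Signed quivers and their symmetric quivers\<close>

text \<open>
  A quiver is a finite directed multigraph, possibly with loops, i.e. an \<^locale>\<open>fin_digraph\<close>.
  The sign function on the disjoint union of vertices and arrows is given by its two
  components \<open>vsign\<close> and \<open>asign\<close>.
\<close>

record ('a, 'b) signed_quiver =
  quiver :: "('a, 'b) pre_digraph"
  vsign :: "'a \<Rightarrow> int"
  asign :: "'b \<Rightarrow> int"
  twins :: "'a set set"

locale signed_quiver = fin_digraph "quiver S" for S :: "('a, 'b) signed_quiver" +
  assumes vsign_range: "i \<in> verts (quiver S) \<Longrightarrow> vsign S i \<in> {-1, 0, 1}"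
    and asign_range: "e \<in> arcs (quiver S) \<Longrightarrow> asign S e \<in> {-1, 0, 1}"
    and twins_pairs: "p \<in> twins S \<Longrightarrow> p \<subseteq> verts (quiver S) \<and> card p = 2"
    and twins_disjoint: "pairwise disjnt (twins S)"
    and twins_unsigned: "i \<in> \<Union>(twins S) \<Longrightarrow> vsign S i = 0"
    and nonloop_signed_iff: "\<lbrakk>e \<in> arcs (quiver S); tail (quiver S) e \<noteq> head (quiver S) e\<rbrakk> \<Longrightarrow>
      asign S e \<noteq> 0 \<longleftrightarrow> {tail (quiver S) e, head (quiver S) e} \<in> twins S"
    and loop_signed_iff: "\<lbrakk>e \<in> arcs (quiver S); tail (quiver S) e = head (quiver S) e\<rbrakk> \<Longrightarrow>
      asign S e \<noteq> 0 \<longleftrightarrow> vsign S (tail (quiver S) e) \<noteq> 0"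

definition twin :: "('a, 'b) signed_quiver \<Rightarrow> 'a \<Rightarrow> 'a" where
  "twin S i = (THE j. j \<noteq> i \<and> {i, j} \<in> twins S)"

text \<open>\<open>Orig x\<close> is the vertex or arrow \<open>x\<close> of the signed quiver, \<open>New x\<close> is the added \<open>x\<^sup>*\<close>.\<close>

datatype 'x cover = Orig 'x | New 'x

primrec vstar :: "('a, 'b) signed_quiver \<Rightarrow> 'a cover \<Rightarrow> 'a cover" where
  "vstar S (Orig i) =
     (if vsign S i \<noteq> 0 then Orig i
      else if i \<in> \<Union>(twins S) then Orig (twin S i)
      else New i)"
| "vstar S (New i) = Orig i"

primrec astar :: "('a, 'b) signed_quiver \<Rightarrow> 'b cover \<Rightarrow> 'b cover" where
  "astar S (Orig e) = (if asign S e \<noteq> 0 then Orig e else New e)"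
| "astar S (New e) = Orig e"

primrec vsign_cover :: "('a, 'b) signed_quiver \<Rightarrow> 'a cover \<Rightarrow> int" where
  "vsign_cover S (Orig i) = vsign S i"
| "vsign_cover S (New i) = 0"

primrec asign_cover :: "('a, 'b) signed_quiver \<Rightarrow> 'b cover \<Rightarrow> int" where
  "asign_cover S (Orig e) = asign S e"
| "asign_cover S (New e) = 0"

definition symmetric_quiver :: "('a, 'b) signed_quiver \<Rightarrow> ('a cover, 'b cover) pre_digraph" where
  "symmetric_quiver S =
     \<lparr>verts = Orig ` verts (quiver S) \<union>
        New ` {i \<in> verts (quiver S). vsign S i = 0 \<and> i \<notin> \<Union>(twins S)},
      arcs = Orig ` arcs (quiver S) \<union> New ` {e \<in> arcs (quiver S). asign S e = 0},
      tail = case_cover (\<lambda>e. Orig (tail (quiver S) e)) (\<lambda>e. vstar S (Orig (head (quiver S) e))),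
      head = case_cover (\<lambda>e. Orig (head (quiver S) e)) (\<lambda>e. vstar S (Orig (tail (quiver S) e)))\<rparr>"

text \<open>The sign \<open>s\<^sub>\<phi>\<close> entering the dual representation; the disequality of truth values is ``exactly one''.\<close>

definition dual_sign :: "('a, 'b) signed_quiver \<Rightarrow> 'b cover \<Rightarrow> int" where
  "dual_sign S e =
     (if (asign_cover S e = -1) \<noteq> (vsign_cover S (head (symmetric_quiver S) e) = -1) then -1 else 1)"


section \<open>Linear algebra on subspaces\<close>

text \<open>
  All vector spaces are subspaces of an ambient vector space, given by its scalar multiplication,
  and linear maps are only specified on their domain.  Any family of finite-dimensional spaces
  embeds into a common ambient space, so this is no restriction.
\<close>

definition fin_dim_subspace :: "('k::field \<Rightarrow> 'v::ab_group_add \<Rightarrow> 'v) \<Rightarrow> 'v set \<Rightarrow> bool" where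
  "fin_dim_subspace s A \<longleftrightarrow>
     module.subspace s A \<and> (\<exists>B. finite B \<and> B \<subseteq> A \<and> module.span s B = A)"

definition linear_map_on :: "('k::field \<Rightarrow> 'v::ab_group_add \<Rightarrow> 'v) \<Rightarrow>
    ('k \<Rightarrow> 'w::ab_group_add \<Rightarrow> 'w) \<Rightarrow> 'v set \<Rightarrow> 'w set \<Rightarrow> ('v \<Rightarrow> 'w) \<Rightarrow> bool" where
  "linear_map_on s t A B f \<longleftrightarrow>
     (\<forall>x\<in>A. f x \<in> B) \<and>
     (\<forall>x\<in>A. \<forall>y\<in>A. f (x + y) = f x + f y) \<and>
     (\<forall>c. \<forall>x\<in>A. f (s c x) = t c (f x))"

text \<open>A functional on \<open>A\<close> is made unique as a function by being zero outside \<open>A\<close>.\<close>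

definition dual_space :: "('k::field \<Rightarrow> 'v::ab_group_add \<Rightarrow> 'v) \<Rightarrow> 'v set \<Rightarrow> ('v \<Rightarrow> 'k) set" where
  "dual_space s A = {g. linear_map_on s (*) A UNIV g \<and> (\<forall>x. x \<notin> A \<longrightarrow> g x = 0)}"

definition dual_scale :: "'k::field \<Rightarrow> ('v \<Rightarrow> 'k) \<Rightarrow> 'v \<Rightarrow> 'k" where
  "dual_scale c g = (\<lambda>x. c * g x)"

text \<open>The transpose of a linear map \<open>f\<close> with domain \<open>A\<close>.\<close>

definition transpose_on :: "'v set \<Rightarrow> ('v \<Rightarrow> 'w) \<Rightarrow> ('w \<Rightarrow> 'k::field) \<Rightarrow> 'v \<Rightarrow> 'k" where
  "transpose_on A f g = (\<lambda>x. if x \<in> A then g (f x) else 0)"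

text \<open>The canonical map from \<open>A\<close> to its double dual.\<close>

definition double_dual :: "('k::field \<Rightarrow> 'v::ab_group_add \<Rightarrow> 'v) \<Rightarrow> 'v set \<Rightarrow> 'v \<Rightarrow> ('v \<Rightarrow> 'k) \<Rightarrow> 'k" where
  "double_dual s A x = (\<lambda>g. if g \<in> dual_space s A then g x else 0)"


section \<open>Quiver representations\<close>

record ('a, 'b, 'v) rep =
  rspace :: "'a \<Rightarrow> 'v set"
  rmap :: "'b \<Rightarrow> 'v \<Rightarrow> 'v"

definition is_rep :: "('k::field \<Rightarrow> 'v::ab_group_add \<Rightarrow> 'v) \<Rightarrow> ('a, 'b) pre_digraph \<Rightarrow>
    ('a, 'b, 'v) rep \<Rightarrow> bool" where
  "is_rep s G V \<longleftrightarrow>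
     (\<forall>i\<in>verts G. fin_dim_subspace s (rspace V i)) \<and>
     (\<forall>e\<in>arcs G. linear_map_on s s (rspace V (tail G e)) (rspace V (head G e)) (rmap V e))"

definition nonzero_rep :: "('a, 'b) pre_digraph \<Rightarrow> ('a, 'b, 'v::zero) rep \<Rightarrow> bool" where
  "nonzero_rep G V \<longleftrightarrow> (\<exists>i\<in>verts G. rspace V i \<noteq> {0})"

definition rep_iso_map :: "('k::field \<Rightarrow> 'v::ab_group_add \<Rightarrow> 'v) \<Rightarrow> ('k \<Rightarrow> 'w::ab_group_add \<Rightarrow> 'w) \<Rightarrow>
    ('a, 'b) pre_digraph \<Rightarrow> ('a, 'b, 'v) rep \<Rightarrow> ('a, 'b, 'w) rep \<Rightarrow> ('a \<Rightarrow> 'v \<Rightarrow> 'w) \<Rightarrow> bool" where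
  "rep_iso_map s t G V W f \<longleftrightarrow>
     (\<forall>i\<in>verts G. linear_map_on s t (rspace V i) (rspace W i) (f i) \<and>
        bij_betw (f i) (rspace V i) (rspace W i)) \<and>
     (\<forall>e\<in>arcs G. \<forall>x\<in>rspace V (tail G e).
        f (head G e) (rmap V e x) = rmap W e (f (tail G e) x))"

definition rep_iso :: "('k::field \<Rightarrow> 'v::ab_group_add \<Rightarrow> 'v) \<Rightarrow> ('k \<Rightarrow> 'w::ab_group_add \<Rightarrow> 'w) \<Rightarrow>
    ('a, 'b) pre_digraph \<Rightarrow> ('a, 'b, 'v) rep \<Rightarrow> ('a, 'b, 'w) rep \<Rightarrow> bool" where
  "rep_iso s t G V W \<longleftrightarrow> (\<exists>f. rep_iso_map s t G V W f)"

text \<open>The direct sum carries the scalar multiplication \<^const>\<open>module_prod.scale\<close>.\<close>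

definition rep_sum :: "('a, 'b, 'v) rep \<Rightarrow> ('a, 'b, 'w) rep \<Rightarrow> ('a, 'b, 'v \<times> 'w) rep" where
  "rep_sum V W =
     \<lparr>rspace = (\<lambda>i. rspace V i \<times> rspace W i), rmap = (\<lambda>e. map_prod (rmap V e) (rmap W e))\<rparr>"

text \<open>
  Direct summands of \<open>V\<close> are isomorphic to subrepresentations of \<open>V\<close>, so it suffices to let the
  summands range over representations inside the same ambient space.
\<close>

definition indecomposable_rep :: "('k::field \<Rightarrow> 'v::ab_group_add \<Rightarrow> 'v) \<Rightarrow> ('a, 'b) pre_digraph \<Rightarrow>
    ('a, 'b, 'v) rep \<Rightarrow> bool" where
  "indecomposable_rep s G V \<longleftrightarrow>
     is_rep s G V \<and> nonzero_rep G V \<and>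
     \<not> (\<exists>A B :: ('a, 'b, 'v) rep.
          is_rep s G A \<and> nonzero_rep G A \<and> is_rep s G B \<and> nonzero_rep G B \<and>
          rep_iso s (module_prod.scale s s) G V (rep_sum A B))"


section \<open>Symmetric representations\<close>

definition dual_rep :: "('k::field \<Rightarrow> 'v::ab_group_add \<Rightarrow> 'v) \<Rightarrow> ('a, 'b) signed_quiver \<Rightarrow>
    ('a cover, 'b cover, 'v) rep \<Rightarrow> ('a cover, 'b cover, 'v \<Rightarrow> 'k) rep" where
  "dual_rep s S V =
     \<lparr>rspace = (\<lambda>i. dual_space s (rspace V (vstar S i))),
      rmap = (\<lambda>e g. dual_scale (of_int (dual_sign S e))
        (transpose_on (rspace V (tail (symmetric_quiver S) (astar S e))) (rmap V (astar S e)) g))\<rparr>"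

text \<open>
  The conditions on the transposes of the \<open>J i\<close> are stated after identifying
  \<open>V (i\<^sup>*)\<close> with its double dual.
\<close>

definition signed_form :: "('k::field \<Rightarrow> 'v::ab_group_add \<Rightarrow> 'v) \<Rightarrow> ('a, 'b) signed_quiver \<Rightarrow>
    ('a cover \<Rightarrow> 'v set) \<Rightarrow> ('a cover \<Rightarrow> 'v \<Rightarrow> 'v \<Rightarrow> 'k) \<Rightarrow> bool" where
  "signed_form s S X J \<longleftrightarrow>
     (\<forall>i\<in>verts (symmetric_quiver S).
        linear_map_on s dual_scale (X i) (dual_space s (X (vstar S i))) (J i) \<and>
        bij_betw (J i) (X i) (dual_space s (X (vstar S i))) \<and>
        (vstar S i \<noteq> i \<longrightarrow>
          (\<forall>y\<in>X (vstar S i). J (vstar S i) y =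
             transpose_on (X i) (J i) (double_dual s (X (vstar S i)) y))) \<and>
        (vstar S i = i \<longrightarrow>
          (\<forall>y\<in>X i. transpose_on (X i) (J i) (double_dual s (X i) y) =
             dual_scale (of_int (vsign_cover S i)) (J i y))))"

definition symmetric_rep :: "('k::field \<Rightarrow> 'v::ab_group_add \<Rightarrow> 'v) \<Rightarrow> ('a, 'b) signed_quiver \<Rightarrow>
    ('a cover, 'b cover, 'v) rep \<Rightarrow> ('a cover \<Rightarrow> 'v \<Rightarrow> 'v \<Rightarrow> 'k) \<Rightarrow> bool" where
  "symmetric_rep s S V J \<longleftrightarrow>
     is_rep s (symmetric_quiver S) V \<and>
     signed_form s S (rspace V) J \<and>
     rep_iso_map s dual_scale (symmetric_quiver S) V (dual_rep s S V) J"

text \<open>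
  The direct sum of the forms \<open>J\<close> and \<open>K\<close> on \<open>V\<close> and \<open>W\<close>, cut off so that its values are
  elements of the \<^const>\<open>dual_space\<close> of \<open>V (i\<^sup>*) \<times> W (i\<^sup>*)\<close>.
\<close>

definition form_sum :: "('a, 'b) signed_quiver \<Rightarrow>
    ('a cover, 'b cover, 'v) rep \<Rightarrow> ('a cover \<Rightarrow> 'v \<Rightarrow> 'v \<Rightarrow> 'k::field) \<Rightarrow>
    ('a cover, 'b cover, 'w) rep \<Rightarrow> ('a cover \<Rightarrow> 'w \<Rightarrow> 'w \<Rightarrow> 'k) \<Rightarrow>
    'a cover \<Rightarrow> 'v \<times> 'w \<Rightarrow> 'v \<times> 'w \<Rightarrow> 'k" where
  "form_sum S V J W K i = (\<lambda>(x, y) (u, v).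
     if u \<in> rspace V (vstar S i) \<and> v \<in> rspace W (vstar S i) then J i x u + K i y v else 0)"

text \<open>An isomorphism of symmetric representations is an isomorphism of representations respecting the forms.\<close>

definition symmetric_rep_iso :: "('k::field \<Rightarrow> 'v::ab_group_add \<Rightarrow> 'v) \<Rightarrow>
    ('k \<Rightarrow> 'w::ab_group_add \<Rightarrow> 'w) \<Rightarrow> ('a, 'b) signed_quiver \<Rightarrow>
    ('a cover, 'b cover, 'v) rep \<Rightarrow> ('a cover \<Rightarrow> 'v \<Rightarrow> 'v \<Rightarrow> 'k) \<Rightarrow>
    ('a cover, 'b cover, 'w) rep \<Rightarrow> ('a cover \<Rightarrow> 'w \<Rightarrow> 'w \<Rightarrow> 'k) \<Rightarrow> bool" where
  "symmetric_rep_iso s t S V J W K \<longleftrightarrow>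
     (\<exists>f. rep_iso_map s t (symmetric_quiver S) V W f \<and>
        (\<forall>i\<in>verts (symmetric_quiver S). \<forall>x\<in>rspace V i.
           J i x = transpose_on (rspace V (vstar S i)) (f (vstar S i)) (K i (f i x))))"

definition indecomposable_symmetric_rep :: "('k::field \<Rightarrow> 'v::ab_group_add \<Rightarrow> 'v) \<Rightarrow>
    ('a, 'b) signed_quiver \<Rightarrow>
    ('a cover, 'b cover, 'v) rep \<Rightarrow> ('a cover \<Rightarrow> 'v \<Rightarrow> 'v \<Rightarrow> 'k) \<Rightarrow> bool" where
  "indecomposable_symmetric_rep s S V J \<longleftrightarrow>
     symmetric_rep s S V J \<and> nonzero_rep (symmetric_quiver S) V \<and>
     \<not> (\<exists>(A :: ('a cover, 'b cover, 'v) rep) JA (B :: ('a cover, 'b cover, 'v) rep) JB.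
          symmetric_rep s S A JA \<and> nonzero_rep (symmetric_quiver S) A \<and>
          symmetric_rep s S B JB \<and> nonzero_rep (symmetric_quiver S) B \<and>
          symmetric_rep_iso s (module_prod.scale s s) S V J
            (rep_sum A B) (form_sum S A JA B JB))"

end

theory Submission
  imports Defs
begin

text \<open>
  The form \<open>\<langle>x, y\<rangle> = J i x y\<close>, for \<open>x \<in> V(i)\<close> and \<open>y \<in> V(i\<^sup>*)\<close>, is a perfect pairing that is
  compatible with the arrows up to the signs \<open>s\<^sub>\<phi>\<close>. Hence every endomorphism \<open>f\<close> of the
  representation \<open>V\<close> has an adjoint endomorphism \<open>f\<^sup>*\<close>, given by \<open>\<langle>f\<^sup>* x, y\<rangle> = \<langle>x, f y\<rangle>\<close>, and
  \<open>f\<^sup>*\<^sup>* = f\<close> because the form is symmetric up to constants.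

  A self-adjoint idempotent \<open>p\<close> splits \<open>V\<close> orthogonally into the symmetric representations
  \<open>pV\<close> and \<open>(1 - p)V\<close>, so indecomposability of \<open>V\<close> as a symmetric representation leaves only
  \<open>p = 0\<close> and \<open>p = 1\<close>. The Fitting projection of a self-adjoint endomorphism is self-adjoint;
  therefore every self-adjoint endomorphism is nilpotent or bijective
  (\<open>selfadjoint_nilpotent_or_bijective\<close>). The rest of the argument only combines this dichotomy.

  If \<open>V\<close> is decomposable as a representation, there is an idempotent endomorphism \<open>e\<close> with
  \<open>e \<noteq> 0\<close> and \<open>e \<noteq> 1\<close>. The self-adjoint \<open>e e\<^sup>*\<close> is not surjective, so it is nilpotent, and then
  \<open>eV\<close> and \<open>e\<^sup>*V\<close> meet in \<open>0\<close>. The self-adjoint \<open>e + e\<^sup>*\<close> is injective on \<open>eV + e\<^sup>*V\<close>, which is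
  not \<open>0\<close>, so it is bijective. Altogether \<open>V = eV \<oplus> e\<^sup>*V\<close>, and the pairing identifies \<open>e\<^sup>*V\<close>
  with the dual of \<open>W = eV\<close> (\<open>iso_image_sum_dual\<close>).

  Finally \<open>W\<close> is automatically indecomposable: a proper idempotent of \<open>W\<close> composed with \<open>e\<close>
  is a proper idempotent \<open>e\<^sub>1\<close> of \<open>V\<close>, so that \<open>V = e\<^sub>1V + e\<^sub>1\<^sup>*V\<close> as well. But \<open>e\<^sub>1V\<close> is a proper
  part of \<open>eV\<close> and \<open>e\<^sub>1\<^sup>*V\<close> lies in \<open>e\<^sup>*V\<close>, contrary to \<open>V = eV \<oplus> e\<^sup>*V\<close>
  (\<open>image_indecomposable\<close>).
\<close>

section \<open>Linear maps on subspaces\<close>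

lemma linear_map_onI:
  assumes "\<And>x. x \<in> A \<Longrightarrow> f x \<in> B"
    and "\<And>x y. x \<in> A \<Longrightarrow> y \<in> A \<Longrightarrow> f (x + y) = f x + f y"
    and "\<And>c x. x \<in> A \<Longrightarrow> f (s c x) = t c (f x)"
  shows "linear_map_on s t A B f"
  using assms by (simp add: linear_map_on_def)

lemma linear_map_onD:
  assumes "linear_map_on s t A B f"
  shows "x \<in> A \<Longrightarrow> f x \<in> B"
    and "x \<in> A \<Longrightarrow> y \<in> A \<Longrightarrow> f (x + y) = f x + f y"
    and "x \<in> A \<Longrightarrow> f (s c x) = t c (f x)"
  using assms by (simp_all add: linear_map_on_def)

lemma linear_map_on_image: "linear_map_on s t A B f \<Longrightarrow> linear_map_on s t A (f ` A) f"
  by (simp add: linear_map_on_def)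

lemma funpow_linear_map_on:
  assumes "linear_map_on s s A A g"
  shows "linear_map_on s s A A (g ^^ n)"
proof (induction n)
  case 0
  show ?case by (simp add: linear_map_on_def)
next
  case (Suc n)
  then show ?case using assms by (simp add: linear_map_on_def)
qed

lemma module_dual_scale: "module (dual_scale :: 'k::field \<Rightarrow> ('v \<Rightarrow> 'k) \<Rightarrow> 'v \<Rightarrow> 'k)"
  by unfold_locales (auto simp: dual_scale_def fun_eq_iff algebra_simps)

lemma module_prod_scale_apply:
  assumes "module s" "module t"
  shows "module_prod.scale s t c (x, y) = (s c x, t c y)"
proof -
  interpret module_prod s t
    using assms by (simp add: module_prod_def module_pair_def)
  show ?thesis by (rule scale_prod)
qed

context vector_space
begin

lemma linear_map_on_zero:
  assumes "linear_map_on scale t A B f" "subspace A"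
  shows "f 0 = 0"
  using linear_map_onD(2)[OF assms(1), of 0 0] subspace_0[OF assms(2)] by simp

lemma linear_map_on_diff:
  assumes f: "linear_map_on scale t A B f" and A: "subspace A" and x: "x \<in> A" and y: "y \<in> A"
  shows "f (x - y) = f x - f y"
  using linear_map_onD(2)[OF f subspace_diff[OF A x y] y] by (simp add: algebra_simps)

lemma dual_space_transpose:
  assumes f: "linear_map_on scale scale A B f" and A: "subspace A" and g: "g \<in> dual_space scale B"
  shows "transpose_on A f g \<in> dual_space scale A"
proof -
  have "linear_map_on scale (*) B UNIV g" using g by (simp add: dual_space_def)
  then have "linear_map_on scale (*) A UNIV (transpose_on A f g)"
    by (intro linear_map_onI)
      (simp_all add: transpose_on_def subspace_add[OF A] subspace_scale[OF A] linear_map_onD[OF f]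
        linear_map_onD)
  then show ?thesis by (simp add: dual_space_def transpose_on_def)
qed

lemma subspace_linear_image_on:
  assumes "linear_map_on scale scale A B f" "subspace A"
  shows "subspace (f ` A)"
proof (rule subspaceI)
  show "0 \<in> f ` A"
    using linear_map_on_zero[OF assms] subspace_0[OF assms(2)] by force
next
  fix x y assume "x \<in> f ` A" "y \<in> f ` A"
  then obtain a b where "a \<in> A" "b \<in> A" "x = f a" "y = f b" by auto
  then show "x + y \<in> f ` A"
    using linear_map_onD(2)[OF assms(1), of a b] subspace_add[OF assms(2)] by force
next
  fix c x assume "x \<in> f ` A"
  then obtain a where "a \<in> A" "x = f a" by auto
  then show "scale c x \<in> f ` A"
    using linear_map_onD(3)[OF assms(1), of a c] subspace_scale[OF assms(2), of a c]
    by (intro image_eqI[of _ _ "scale c a"]) simp_all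
qed

lemma subspace_linear_kernel_on:
  assumes f: "linear_map_on scale scale A B f" and A: "subspace A"
  shows "subspace {x \<in> A. f x = 0}"
proof (rule subspaceI)
  show "0 \<in> {x \<in> A. f x = 0}"
    using linear_map_on_zero[OF assms] subspace_0[OF A] by simp
next
  fix x y assume "x \<in> {x \<in> A. f x = 0}" "y \<in> {x \<in> A. f x = 0}"
  then show "x + y \<in> {x \<in> A. f x = 0}"
    using linear_map_onD(2)[OF f] subspace_add[OF A] by simp
next
  fix c x assume "x \<in> {x \<in> A. f x = 0}"
  then show "scale c x \<in> {x \<in> A. f x = 0}"
    using linear_map_onD(3)[OF f] subspace_scale[OF A] by simp
qed

lemma fin_dim_subspace_subset:
  assumes A: "fin_dim_subspace scale A" and U: "subspace U" "U \<subseteq> A"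
  shows "fin_dim_subspace scale U"
proof -
  obtain B where B: "finite B" "span B = A"
    using A by (auto simp: fin_dim_subspace_def)
  obtain C where C: "C \<subseteq> U" "independent C" "U \<subseteq> span C"
    by (rule basis_exists)
  have "finite C"
    using independent_span_bound[OF B(1) C(2)] C(1) U(2) B(2) by auto
  moreover have "span C = U"
    using C U(1) by (simp add: span_minimal subset_antisym)
  ultimately show ?thesis
    using U(1) C(1) by (auto simp: fin_dim_subspace_def)
qed

text \<open>
  Makes dimension a strictly monotone measure on the subspaces of a finitely spanned space, so
  that the kernels and the images of the powers of an endomorphism each become constant.
\<close>
lemma subspace_eq_if_dim_le:
  assumes B: "finite B" "U' \<subseteq> span B" and U: "subspace U" "U \<subseteq> U'" and le: "dim U' \<le> dim U"
  shows "U' = U"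
proof (rule ccontr)
  assume "U' \<noteq> U"
  then obtain x where x: "x \<in> U'" "x \<notin> U" using U by auto
  obtain C where C: "C \<subseteq> U" "independent C" "U \<subseteq> span C" "card C = dim U"
    by (rule basis_exists)
  obtain D where D: "D \<subseteq> U'" "independent D" "U' \<subseteq> span D" "card D = dim U'"
    by (rule basis_exists)
  have "span C \<subseteq> U" using C(1) U(1) by (simp add: span_minimal)
  then have xC: "x \<notin> span C" using x(2) by auto
  have finD: "finite D"
    using independent_span_bound[OF B(1) D(2)] D(1) B(2) by auto
  have "insert x C \<subseteq> span D" using x(1) C(1) U(2) D(3) by auto
  then have "finite (insert x C) \<and> card (insert x C) \<le> card D"
    by (rule independent_span_bound[OF finD independent_insertI[OF xC C(2)]])
  moreover have "x \<notin> C" using xC span_base by blast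
  ultimately show False using C(4) D(4) le by auto
qed

text \<open>
  Fitting's lemma. Both the kernels and the images of the powers of \<open>g\<close> become constant,
  and once \<open>n\<close> is so large that the passage from \<open>n\<close> to \<open>n + n\<close> changes neither, the
  kernel and the image of \<open>g ^^ n\<close> are complementary. Keeping the bound valid for
  every larger exponent is what permits one common exponent at finitely many vertices.
\<close>
lemma fitting:
  assumes A: "fin_dim_subspace scale A" and g: "linear_map_on scale scale A A g"
  shows "\<exists>N. \<forall>n\<ge>N. (\<forall>a\<in>A. (g ^^ n) ((g ^^ n) a) = 0 \<longrightarrow> (g ^^ n) a = 0) \<and>
    (\<forall>x\<in>A. \<exists>a\<in>A. (g ^^ n) (x - (g ^^ n) a) = 0)"
proof -
  obtain B where B: "finite B" "span B = A" and subA: "subspace A"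
    using A by (auto simp: fin_dim_subspace_def)
  note gn = funpow_linear_map_on[OF g]
  note gA = linear_map_onD(1)[OF gn]
  define K where "K n = {x \<in> A. (g ^^ n) x = 0}" for n
  define I where "I n = (g ^^ n) ` A" for n
  have bound: "dim U \<le> card B" if "U \<subseteq> A" for U
    using dim_le_card[of U B] that B by auto
  have K_mono: "K m \<subseteq> K (m + k)" for m k
    using linear_map_on_zero[OF gn subA, of k]
    by (auto simp: K_def add.commute[of m k] funpow_add)
  have I_mono: "I (m + k) \<subseteq> I m" for m k
    using gA by (auto simp: I_def funpow_add)
  have K_sub: "subspace (K n)" for n
    unfolding K_def by (rule subspace_linear_kernel_on[OF gn subA])
  have I_sub: "subspace (I n)" for n
    unfolding I_def by (rule subspace_linear_image_on[OF gn subA])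
  have "\<exists>N. True \<and> (\<forall>n. True \<longrightarrow> dim (K n) \<le> dim (K N))"
    by (rule ex_has_greatest_nat[where b = "Suc (card B)" and k = 0])
      (use bound[of "K _"] in \<open>auto simp: K_def less_Suc_eq_le\<close>)
  then obtain N1 where N1: "\<And>n. dim (K n) \<le> dim (K N1)" by blast
  have "\<exists>N. True \<and> (\<forall>n. True \<longrightarrow> dim (I N) \<le> dim (I n))"
    by (rule ex_has_least_nat[where k = 0]) simp
  then obtain N2 where N2: "\<And>n. dim (I N2) \<le> dim (I n)" by blast
  have K_stable: "K (N1 + k) = K N1" for k
    by (rule subspace_eq_if_dim_le[OF B(1)]) (use K_sub K_mono N1 B in \<open>auto simp: K_def\<close>)
  have I_stable: "I N2 = I (N2 + k)" for k
    by (rule subspace_eq_if_dim_le[OF B(1)]) (use I_sub I_mono N2 B gA in \<open>auto simp: I_def\<close>)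
  show ?thesis
  proof (intro exI[of _ "N1 + N2"] allI impI conjI ballI)
    fix n a assume n: "N1 + N2 \<le> n" and a: "a \<in> A" and 0: "(g ^^ n) ((g ^^ n) a) = 0"
    have "a \<in> K (n + n)" using a 0 by (simp add: K_def funpow_add)
    also have "K (n + n) = K n"
      using K_stable[of "n - N1"] K_stable[of "n + n - N1"] n by simp
    finally show "(g ^^ n) a = 0" by (simp add: K_def)
  next
    fix n x assume n: "N1 + N2 \<le> n" and x: "x \<in> A"
    have "I n = I (n + n)"
      using I_stable[of "n - N2"] I_stable[of "n + n - N2"] n by simp
    then have "(g ^^ n) x \<in> I (n + n)" using x by (auto simp: I_def)
    then obtain a where a: "a \<in> A" "(g ^^ n) x = (g ^^ n) ((g ^^ n) a)"
      by (auto simp: I_def funpow_add)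
    then have "(g ^^ n) (x - (g ^^ n) a) = 0"
      using linear_map_on_diff[OF gn subA x gA] by simp
    then show "\<exists>a\<in>A. (g ^^ n) (x - (g ^^ n) a) = 0" using a(1) by blast
  qed
qed

end

section \<open>Endomorphisms and direct summands of representations\<close>

definition rep_endo :: "('k::field \<Rightarrow> 'v::ab_group_add \<Rightarrow> 'v) \<Rightarrow> ('a, 'b) pre_digraph \<Rightarrow>
    ('a, 'b, 'v) rep \<Rightarrow> ('a \<Rightarrow> 'v \<Rightarrow> 'v) \<Rightarrow> bool" where
  "rep_endo s G V f \<longleftrightarrow>
     (\<forall>i\<in>verts G. linear_map_on s s (rspace V i) (rspace V i) (f i)) \<and>
     (\<forall>e\<in>arcs G. \<forall>x\<in>rspace V (tail G e). f (head G e) (rmap V e x) = rmap V e (f (tail G e) x))"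

definition idempotent_endo :: "('k::field \<Rightarrow> 'v::ab_group_add \<Rightarrow> 'v) \<Rightarrow> ('a, 'b) pre_digraph \<Rightarrow>
    ('a, 'b, 'v) rep \<Rightarrow> ('a \<Rightarrow> 'v \<Rightarrow> 'v) \<Rightarrow> bool" where
  "idempotent_endo s G V p \<longleftrightarrow>
     rep_endo s G V p \<and> (\<forall>i\<in>verts G. \<forall>x\<in>rspace V i. p i (p i x) = p i x)"

definition rep_image :: "('a, 'b, 'v) rep \<Rightarrow> ('a \<Rightarrow> 'v \<Rightarrow> 'v) \<Rightarrow> ('a, 'b, 'v) rep" where
  "rep_image V f = \<lparr>rspace = (\<lambda>i. f i ` rspace V i), rmap = rmap V\<rparr>"

lemma rep_image_simps [simp]:
  "rspace (rep_image V f) i = f i ` rspace V i"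
  "rmap (rep_image V f) = rmap V"
  by (simp_all add: rep_image_def)

lemma nonzero_rep_imageI:
  "i \<in> verts G \<Longrightarrow> x \<in> rspace V i \<Longrightarrow> f i x \<noteq> 0 \<Longrightarrow> nonzero_rep G (rep_image V f)"
  unfolding nonzero_rep_def by (intro bexI[of _ i]) auto

lemma rep_endoD:
  assumes "rep_endo s G V f"
  shows "i \<in> verts G \<Longrightarrow> linear_map_on s s (rspace V i) (rspace V i) (f i)"
    and "i \<in> verts G \<Longrightarrow> x \<in> rspace V i \<Longrightarrow> f i x \<in> rspace V i"
    and "e \<in> arcs G \<Longrightarrow> x \<in> rspace V (tail G e) \<Longrightarrow>
      f (head G e) (rmap V e x) = rmap V e (f (tail G e) x)"
  using assms by (auto simp: rep_endo_def linear_map_on_def)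

locale quiver_rep = vector_space s + wf_digraph G
  for s :: "'k::field \<Rightarrow> 'v::ab_group_add \<Rightarrow> 'v" and G :: "('a, 'b) pre_digraph" +
  fixes V :: "('a, 'b, 'v) rep"
  assumes is_rep: "is_rep s G V"
begin

lemma fin_dim: "i \<in> verts G \<Longrightarrow> fin_dim_subspace s (rspace V i)"
  using is_rep by (simp add: is_rep_def)

lemma subspace_rspace: "i \<in> verts G \<Longrightarrow> subspace (rspace V i)"
  using fin_dim by (simp add: fin_dim_subspace_def)

lemma rmap_linear:
  "e \<in> arcs G \<Longrightarrow> linear_map_on s s (rspace V (tail G e)) (rspace V (head G e)) (rmap V e)"
  using is_rep by (simp add: is_rep_def)

lemma rmap_closed: "e \<in> arcs G \<Longrightarrow> x \<in> rspace V (tail G e) \<Longrightarrow> rmap V e x \<in> rspace V (head G e)"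
  using linear_map_onD(1)[OF rmap_linear] .

text \<open>
  The image of an endomorphism is stable under the arrows because the endomorphism commutes
  with them; the images of idempotents are the direct summands used below.
\<close>
lemma is_rep_image:
  assumes f: "rep_endo s G V f"
  shows "is_rep s G (rep_image V f)"
  unfolding is_rep_def
proof (intro conjI ballI)
  fix i assume i: "i \<in> verts G"
  show "fin_dim_subspace s (rspace (rep_image V f) i)"
    using fin_dim_subspace_subset[OF fin_dim[OF i]]
      subspace_linear_image_on[OF rep_endoD(1)[OF f i] subspace_rspace[OF i]] rep_endoD(2)[OF f i]
    by (simp add: image_subset_iff)
next
  fix e assume e: "e \<in> arcs G"
  note V = rep_endoD(2)[OF f tail_in_verts[OF e]]
  show "linear_map_on s s (rspace (rep_image V f) (tail G e)) (rspace (rep_image V f) (head G e))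
    (rmap (rep_image V f) e)"
  proof (rule linear_map_onI)
    fix x assume "x \<in> rspace (rep_image V f) (tail G e)"
    then obtain y where y: "y \<in> rspace V (tail G e)" "x = f (tail G e) y" by auto
    then have "rmap V e x = f (head G e) (rmap V e y)"
      using rep_endoD(3)[OF f e] by simp
    then show "rmap (rep_image V f) e x \<in> rspace (rep_image V f) (head G e)"
      using rmap_closed[OF e y(1)] by simp
  qed (use V linear_map_onD(2,3)[OF rmap_linear[OF e]] in auto)
qed

lemma rep_endo_comp:
  assumes f: "rep_endo s G V f" and g: "rep_endo s G V g"
  shows "rep_endo s G V (\<lambda>i x. f i (g i x))"
  using assms unfolding rep_endo_def linear_map_on_def by simp

lemma rep_endo_add:
  assumes f: "rep_endo s G V f" and g: "rep_endo s G V g"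
  shows "rep_endo s G V (\<lambda>i x. f i x + g i x)"
  unfolding rep_endo_def
proof (intro conjI ballI)
  fix i assume i: "i \<in> verts G"
  show "linear_map_on s s (rspace V i) (rspace V i) (\<lambda>x. f i x + g i x)"
    by (rule linear_map_onI)
      (use linear_map_onD[OF rep_endoD(1)[OF f i]] linear_map_onD[OF rep_endoD(1)[OF g i]]
        subspace_add[OF subspace_rspace[OF i]] in \<open>auto simp: scale_right_distrib\<close>)
next
  fix e x assume e: "e \<in> arcs G" and x: "x \<in> rspace V (tail G e)"
  show "f (head G e) (rmap V e x) + g (head G e) (rmap V e x) =
      rmap V e (f (tail G e) x + g (tail G e) x)"
    using rep_endoD(2,3)[OF f] rep_endoD(2,3)[OF g] linear_map_onD(2)[OF rmap_linear[OF e]] e x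
    by simp
qed

lemma rep_endo_complement:
  assumes f: "rep_endo s G V f"
  shows "rep_endo s G V (\<lambda>i x. x - f i x)"
  unfolding rep_endo_def
proof (intro conjI ballI)
  fix i assume i: "i \<in> verts G"
  show "linear_map_on s s (rspace V i) (rspace V i) (\<lambda>x. x - f i x)"
    by (rule linear_map_onI)
      (use linear_map_onD[OF rep_endoD(1)[OF f i]]
        subspace_diff[OF subspace_rspace[OF i]] in \<open>auto simp: scale_right_diff_distrib\<close>)
next
  fix e x assume e: "e \<in> arcs G" and x: "x \<in> rspace V (tail G e)"
  show "rmap V e x - f (head G e) (rmap V e x) = rmap V e (x - f (tail G e) x)"
    using rep_endoD(2,3)[OF f] linear_map_on_diff[OF rmap_linear[OF e] subspace_rspace] e x
    by simp
qed

lemma idempotent_complement: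
  assumes p: "idempotent_endo s G V p"
  shows "idempotent_endo s G V (\<lambda>i x. x - p i x)"
  unfolding idempotent_endo_def
proof (intro conjI ballI)
  show "rep_endo s G V (\<lambda>i x. x - p i x)"
    using p by (intro rep_endo_complement) (simp add: idempotent_endo_def)
next
  fix i x assume i: "i \<in> verts G" and x: "x \<in> rspace V i"
  have e: "rep_endo s G V p" using p by (simp add: idempotent_endo_def)
  show "x - p i x - p i (x - p i x) = x - p i x"
    using linear_map_on_diff[OF rep_endoD(1)[OF e i] subspace_rspace[OF i] x rep_endoD(2)[OF e i x]]
      p i x by (simp add: idempotent_endo_def)
qed

text \<open>
  Transporting the projection of \<open>A \<oplus> B\<close> onto \<open>A\<close> along the isomorphism turns an abstract
  decomposition into an idempotent endomorphism, different from \<open>0\<close> because \<open>A\<close> is nonzero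
  and from \<open>1\<close> because \<open>B\<close> is.
\<close>
lemma idempotent_if_decomposable:
  assumes nz: "nonzero_rep G V" and dec: "\<not> indecomposable_rep s G V"
  obtains p where "idempotent_endo s G V p"
    and "\<exists>i\<in>verts G. \<exists>x\<in>rspace V i. p i x \<noteq> 0"
    and "\<exists>i\<in>verts G. \<exists>x\<in>rspace V i. p i x \<noteq> x"
proof -
  obtain A B :: "('a, 'b, 'v) rep" where A: "is_rep s G A" "nonzero_rep G A"
    and B: "is_rep s G B" "nonzero_rep G B"
    and "rep_iso s (module_prod.scale s s) G V (rep_sum A B)"
    using nz dec is_rep unfolding indecomposable_rep_def by blast
  then obtain \<phi> where \<phi>: "rep_iso_map s (module_prod.scale s s) G V (rep_sum A B) \<phi>"
    by (auto simp: rep_iso_def)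
  interpret A: quiver_rep s G A using A by unfold_locales
  interpret B: quiver_rep s G B using B by unfold_locales
  have \<phi>_lin: "linear_map_on s (module_prod.scale s s) (rspace V i) (rspace A i \<times> rspace B i) (\<phi> i)"
    and \<phi>_bij: "bij_betw (\<phi> i) (rspace V i) (rspace A i \<times> rspace B i)" if "i \<in> verts G" for i
    using \<phi> that by (auto simp: rep_iso_map_def rep_sum_def)
  have \<phi>_comm: "\<phi> (head G e) (rmap V e x) = map_prod (rmap A e) (rmap B e) (\<phi> (tail G e) x)"
    if "e \<in> arcs G" "x \<in> rspace V (tail G e)" for e x
    using \<phi> that by (auto simp: rep_iso_map_def rep_sum_def)
  define \<psi> where "\<psi> i = inv_into (rspace V i) (\<phi> i)" for i
  define p where "p i x = \<psi> i (fst (\<phi> i x), 0)" for i x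
  have \<phi>\<psi>: "\<phi> i (\<psi> i ab) = ab" and \<psi>V: "\<psi> i ab \<in> rspace V i"
    if "i \<in> verts G" "ab \<in> rspace A i \<times> rspace B i" for i ab
    using \<phi>_bij[OF that(1)] that(2) unfolding \<psi>_def bij_betw_def
    by (simp_all add: f_inv_into_f inv_into_into)
  have \<phi>_in: "\<phi> i x \<in> rspace A i \<times> rspace B i" if "i \<in> verts G" "x \<in> rspace V i" for i x
    using linear_map_onD(1)[OF \<phi>_lin] that .
  have fst_in: "(fst (\<phi> i x), 0) \<in> rspace A i \<times> rspace B i"
    if "i \<in> verts G" "x \<in> rspace V i" for i x
    using \<phi>_in[OF that] subspace_0[OF B.subspace_rspace[OF that(1)]] by auto
  have pV: "p i x \<in> rspace V i" and \<phi>p: "\<phi> i (p i x) = (fst (\<phi> i x), 0)"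
    if "i \<in> verts G" "x \<in> rspace V i" for i x
    using \<psi>V \<phi>\<psi> fst_in[OF that] that by (auto simp: p_def)
  have eqI: "x = y" if "i \<in> verts G" "x \<in> rspace V i" "y \<in> rspace V i" "\<phi> i x = \<phi> i y" for i x y
    using \<phi>_bij[OF that(1)] that by (auto simp: bij_betw_def dest: inj_onD)
  have ms: "module_prod.scale s s c (x, y) = (s c x, s c y)" for c x y
    by (rule module_prod_scale_apply) (rule module_axioms)+
  have "rep_endo s G V p"
    unfolding rep_endo_def
  proof (intro conjI ballI)
    fix i assume i: "i \<in> verts G"
    note V = subspace_rspace[OF i]
    note lin = linear_map_onD(2,3)[OF \<phi>_lin[OF i]]
    show "linear_map_on s s (rspace V i) (rspace V i) (p i)"
    proof (rule linear_map_onI)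
      fix x assume x: "x \<in> rspace V i"
      show "p i x \<in> rspace V i" using pV[OF i x] .
    next
      fix x y assume x: "x \<in> rspace V i" and y: "y \<in> rspace V i"
      show "p i (x + y) = p i x + p i y"
        by (rule eqI[OF i]) (simp_all add: pV \<phi>p i x y lin subspace_add[OF V])
    next
      fix c x assume x: "x \<in> rspace V i"
      have "module_prod.scale s s c (\<phi> i x) = (s c (fst (\<phi> i x)), s c (snd (\<phi> i x)))"
        using ms[of c "fst (\<phi> i x)" "snd (\<phi> i x)"] by simp
      then show "p i (s c x) = s c (p i x)"
        by (intro eqI[OF i]) (simp_all add: pV \<phi>p i x lin subspace_scale[OF V] ms)
    qed
  next
    fix e x assume e: "e \<in> arcs G" and x: "x \<in> rspace V (tail G e)"
    note [simp] = tail_in_verts[OF e] head_in_verts[OF e]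
    have "rmap B e 0 = 0"
      using linear_map_on_zero[OF B.rmap_linear[OF e] B.subspace_rspace] by simp
    then show "p (head G e) (rmap V e x) = rmap V e (p (tail G e) x)"
      by (intro eqI[of "head G e"]) (simp_all add: pV \<phi>p \<phi>_comm e x rmap_closed)
  qed
  moreover have "p i (p i x) = p i x" if "i \<in> verts G" "x \<in> rspace V i" for i x
    by (rule eqI[OF that(1)]) (simp_all add: pV \<phi>p that)
  ultimately have "idempotent_endo s G V p" by (simp add: idempotent_endo_def)
  moreover have "\<exists>i\<in>verts G. \<exists>x\<in>rspace V i. p i x \<noteq> 0"
  proof -
    obtain i a where i: "i \<in> verts G" and a: "a \<in> rspace A i" "a \<noteq> 0"
      using A(2) A.subspace_rspace subspace_0 unfolding nonzero_rep_def by blast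
    have in_AB: "(a, 0) \<in> rspace A i \<times> rspace B i"
      using a subspace_0[OF B.subspace_rspace[OF i]] by simp
    have "\<phi> i (p i (\<psi> i (a, 0))) = (a, 0)"
      using \<phi>p[OF i \<psi>V[OF i in_AB]] \<phi>\<psi>[OF i in_AB] by simp
    moreover have "\<phi> i 0 = (0, 0)"
      using linear_map_on_zero[OF \<phi>_lin[OF i] subspace_rspace[OF i]] by (simp add: zero_prod_def)
    ultimately have "p i (\<psi> i (a, 0)) \<noteq> 0" using a(2) by auto
    then show ?thesis using i \<psi>V[OF i in_AB] by blast
  qed
  moreover have "\<exists>i\<in>verts G. \<exists>x\<in>rspace V i. p i x \<noteq> x"
  proof -
    obtain i b where i: "i \<in> verts G" and b: "b \<in> rspace B i" "b \<noteq> 0"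
      using B(2) B.subspace_rspace subspace_0 unfolding nonzero_rep_def by blast
    have in_AB: "(0, b) \<in> rspace A i \<times> rspace B i"
      using b subspace_0[OF A.subspace_rspace[OF i]] by simp
    have "\<phi> i (p i (\<psi> i (0, b))) \<noteq> \<phi> i (\<psi> i (0, b))"
      using \<phi>p[OF i \<psi>V[OF i in_AB]] \<phi>\<psi>[OF i in_AB] b(2) by simp
    then show ?thesis using i \<psi>V[OF i in_AB] by metis
  qed
  ultimately show thesis by (rule that)
qed

end

section \<open>The involution of the symmetric quiver\<close>

context signed_quiver
begin

lemma twin_unique:
  assumes i: "i \<in> \<Union>(twins S)"
  shows "\<exists>!j. j \<noteq> i \<and> {i, j} \<in> twins S"
proof -
  obtain p where p: "p \<in> twins S" "i \<in> p" using i by auto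
  obtain a b where "p = {a, b}" "a \<noteq> b"
    using twins_pairs[OF p(1)] by (auto simp: card_2_iff)
  then obtain j where j: "j \<noteq> i" "{i, j} \<in> twins S"
    using p by (metis insertE insert_commute singletonD)
  show ?thesis
  proof (rule ex1I[of _ j])
    fix k assume k: "k \<noteq> i \<and> {i, k} \<in> twins S"
    have "{i, k} = {i, j}"
      using pairwiseD[OF twins_disjoint, of "{i, k}" "{i, j}"] k j by (auto simp: disjnt_def)
    then show "k = j" using j(1) by auto
  qed (use j in simp)
qed

lemma twin_eqI: "{i, j} \<in> twins S \<Longrightarrow> i \<noteq> j \<Longrightarrow> twin S i = j"
  unfolding twin_def using twin_unique[of i] by (intro the1_equality) auto

lemma twin_props:
  assumes "i \<in> \<Union>(twins S)"
  shows "twin S i \<noteq> i" "{i, twin S i} \<in> twins S"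
  using theI'[OF twin_unique[OF assms]] by (simp_all add: twin_def)

lemma twin_twin: "i \<in> \<Union>(twins S) \<Longrightarrow> twin S (twin S i) = i"
  using twin_props[of i] by (intro twin_eqI) (auto simp: insert_commute)

lemma vstar_vstar: "i \<in> verts (symmetric_quiver S) \<Longrightarrow> vstar S (vstar S i) = i"
proof (cases i)
  case (Orig j)
  show ?thesis
  proof (cases "j \<in> \<Union>(twins S)")
    case True
    then have "twin S j \<in> \<Union>(twins S)" using twin_props(2) by blast
    then show ?thesis
      using twin_twin[OF True] twins_unsigned True by (simp add: Orig)
  qed (auto simp: Orig)
qed (auto simp: symmetric_quiver_def)

lemma vstar_in_verts:
  assumes "i \<in> verts (symmetric_quiver S)"
  shows "vstar S i \<in> verts (symmetric_quiver S)"
proof (cases i)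
  case (Orig j)
  then have j: "j \<in> verts (quiver S)" using assms by (auto simp: symmetric_quiver_def)
  show ?thesis
  proof (cases "j \<in> \<Union>(twins S)")
    case True
    then have "twin S j \<in> verts (quiver S)" using twin_props(2) twins_pairs by blast
    then show ?thesis using True twins_unsigned by (auto simp: Orig symmetric_quiver_def)
  qed (use j in \<open>auto simp: Orig symmetric_quiver_def\<close>)
qed (use assms in \<open>auto simp: symmetric_quiver_def\<close>)

lemma fin_digraph_symmetric_quiver: "fin_digraph (symmetric_quiver S)"
proof
  fix e assume "e \<in> arcs (symmetric_quiver S)"
  then obtain a where a: "a \<in> arcs (quiver S)" "e = Orig a \<or> e = New a"
    by (auto simp: symmetric_quiver_def)
  have t: "Orig (tail (quiver S) a) \<in> verts (symmetric_quiver S)"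
    and h: "Orig (head (quiver S) a) \<in> verts (symmetric_quiver S)"
    using a(1) by (simp_all add: symmetric_quiver_def)
  have "tail (symmetric_quiver S) e \<in> {Orig (tail (quiver S) a), vstar S (Orig (head (quiver S) a))}"
    and "head (symmetric_quiver S) e \<in> {Orig (head (quiver S) a), vstar S (Orig (tail (quiver S) a))}"
    using a(2) by (auto simp: symmetric_quiver_def simp del: vstar.simps)
  then show "tail (symmetric_quiver S) e \<in> verts (symmetric_quiver S)"
    and "head (symmetric_quiver S) e \<in> verts (symmetric_quiver S)"
    using t h vstar_in_verts[OF t] vstar_in_verts[OF h] by auto
next
  show "finite (verts (symmetric_quiver S))" "finite (arcs (symmetric_quiver S))"
    by (simp_all add: symmetric_quiver_def)
qed

text \<open>
  A signed arrow runs between twins or is a loop at a fixed vertex; in both cases \<open>*\<close> exchanges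
  its endpoints, which is what lets \<open>astar\<close> fix the arrow.
\<close>
lemma signed_arc_star:
  assumes e: "e \<in> arcs (quiver S)" "asign S e \<noteq> 0"
  shows "vstar S (Orig (head (quiver S) e)) = Orig (tail (quiver S) e)"
    and "vstar S (Orig (tail (quiver S) e)) = Orig (head (quiver S) e)"
proof -
  let ?t = "tail (quiver S) e" and ?h = "head (quiver S) e"
  have "vstar S (Orig ?h) = Orig ?t \<and> vstar S (Orig ?t) = Orig ?h"
  proof (cases "?t = ?h")
    case True
    then show ?thesis using loop_signed_iff[OF e(1) True] e(2) by simp
  next
    case False
    then have tw: "{?t, ?h} \<in> twins S" using nonloop_signed_iff[OF e(1)] e(2) by simp
    then have "twin S ?t = ?h" "twin S ?h = ?t"
      using False by (auto intro!: twin_eqI simp: insert_commute)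
    moreover have "?t \<in> \<Union>(twins S)" "?h \<in> \<Union>(twins S)" using tw by blast+
    ultimately show ?thesis using twins_unsigned by simp
  qed
  then show "vstar S (Orig ?h) = Orig ?t" "vstar S (Orig ?t) = Orig ?h" by simp_all
qed

lemma astar_arc:
  assumes "e \<in> arcs (symmetric_quiver S)"
  shows "astar S e \<in> arcs (symmetric_quiver S)"
    and "tail (symmetric_quiver S) (astar S e) = vstar S (head (symmetric_quiver S) e)"
    and "head (symmetric_quiver S) (astar S e) = vstar S (tail (symmetric_quiver S) e)"
proof -
  have inv: "vstar S (vstar S (Orig v)) = Orig v" if "v \<in> verts (quiver S)" for v
    using that by (intro vstar_vstar) (simp add: symmetric_quiver_def)
  consider (old) a where "e = Orig a" "a \<in> arcs (quiver S)"
    | (new) a where "e = New a" "a \<in> arcs (quiver S)" "asign S a = 0"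
    using assms by (auto simp: symmetric_quiver_def)
  then have "astar S e \<in> arcs (symmetric_quiver S) \<and>
    tail (symmetric_quiver S) (astar S e) = vstar S (head (symmetric_quiver S) e) \<and>
    head (symmetric_quiver S) (astar S e) = vstar S (tail (symmetric_quiver S) e)"
  proof cases
    case (old a)
    then show ?thesis using signed_arc_star[of a]
      by (cases "asign S a = 0") (simp_all add: symmetric_quiver_def del: vstar.simps)
  next
    case (new a)
    then show ?thesis using inv by (simp add: symmetric_quiver_def del: vstar.simps)
  qed
  then show "astar S e \<in> arcs (symmetric_quiver S)"
    "tail (symmetric_quiver S) (astar S e) = vstar S (head (symmetric_quiver S) e)"
    "head (symmetric_quiver S) (astar S e) = vstar S (tail (symmetric_quiver S) e)" by simp_all
qed

end

section \<open>Adjoints with respect to a signed form\<close>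

locale symmetric_representation = vector_space s + sq: signed_quiver S
  for s :: "'k::field \<Rightarrow> 'v::ab_group_add \<Rightarrow> 'v" and S :: "('a, 'b) signed_quiver" +
  fixes V :: "('a cover, 'b cover, 'v) rep" and J :: "'a cover \<Rightarrow> 'v \<Rightarrow> 'v \<Rightarrow> 'k"
  assumes symmetric: "symmetric_rep s S V J"
begin

abbreviation Q :: "('a cover, 'b cover) pre_digraph" where
  "Q \<equiv> symmetric_quiver S"

sublocale Q: fin_digraph Q
  by (rule sq.fin_digraph_symmetric_quiver)

sublocale quiver_rep s Q V
  by unfold_locales (use symmetric in \<open>auto simp: symmetric_rep_def\<close>)

lemma star_verts [simp]: "i \<in> verts Q \<Longrightarrow> vstar S i \<in> verts Q"
  by (rule sq.vstar_in_verts)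

lemma star_star [simp]: "i \<in> verts Q \<Longrightarrow> vstar S (vstar S i) = i"
  by (rule sq.vstar_vstar)

lemma J_linear:
  "i \<in> verts Q \<Longrightarrow>
    linear_map_on s dual_scale (rspace V i) (dual_space s (rspace V (vstar S i))) (J i)"
  and J_bij: "i \<in> verts Q \<Longrightarrow> bij_betw (J i) (rspace V i) (dual_space s (rspace V (vstar S i)))"
  using symmetric by (simp_all add: symmetric_rep_def signed_form_def)

lemma J_functional:
  assumes "i \<in> verts Q" "x \<in> rspace V i"
  shows "J i x \<in> dual_space s (rspace V (vstar S i))"
    and "linear_map_on s (*) (rspace V (vstar S i)) UNIV (J i x)"
    and "y \<notin> rspace V (vstar S i) \<Longrightarrow> J i x y = 0"
  using linear_map_onD(1)[OF J_linear[OF assms(1)] assms(2)] by (simp_all add: dual_space_def)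

lemma J_eqI:
  assumes i: "i \<in> verts Q" and x: "x \<in> rspace V i" "x' \<in> rspace V i"
    and eq: "\<And>y. y \<in> rspace V (vstar S i) \<Longrightarrow> J i x y = J i x' y"
  shows "x = x'"
proof -
  have "J i x = J i x'"
    using eq J_functional(3)[OF i] x by (metis ext)
  then show ?thesis
    using J_bij[OF i] x by (auto simp: bij_betw_def dest: inj_onD)
qed

lemma J_onto:
  assumes "i \<in> verts Q" "g \<in> dual_space s (rspace V (vstar S i))"
  obtains x where "x \<in> rspace V i" "J i x = g"
proof -
  have "g \<in> J i ` rspace V i"
    using J_bij[OF assms(1)] assms(2) by (simp add: bij_betw_def)
  then show thesis using that by blast
qed

lemma J_add_right:
  "i \<in> verts Q \<Longrightarrow> x \<in> rspace V i \<Longrightarrow> y \<in> rspace V (vstar S i) \<Longrightarrow> z \<in> rspace V (vstar S i) \<Longrightarrow>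
    J i x (y + z) = J i x y + J i x z"
  using linear_map_onD(2)[OF J_functional(2)] .

lemma J_add_left:
  "i \<in> verts Q \<Longrightarrow> x \<in> rspace V i \<Longrightarrow> x' \<in> rspace V i \<Longrightarrow> J i (x + x') y = J i x y + J i x' y"
  using linear_map_onD(2)[OF J_linear, of i x x'] by simp

lemma J_scale_left:
  "i \<in> verts Q \<Longrightarrow> x \<in> rspace V i \<Longrightarrow> J i (s c x) y = c * J i x y"
  using linear_map_onD(3)[OF J_linear, of i x c] by (simp add: dual_scale_def)

lemma J_symmetric_moved:
  assumes i: "i \<in> verts Q" "vstar S i \<noteq> i" and x: "x \<in> rspace V i" and y: "y \<in> rspace V (vstar S i)"
  shows "J (vstar S i) y x = J i x y"
proof -
  have "J (vstar S i) y = transpose_on (rspace V i) (J i) (double_dual s (rspace V (vstar S i)) y)"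
    using symmetric i y by (simp add: symmetric_rep_def signed_form_def)
  then show ?thesis
    using x J_functional(1)[OF i(1) x] by (simp add: transpose_on_def double_dual_def)
qed

lemma J_symmetric_fixed:
  assumes i: "i \<in> verts Q" "vstar S i = i" and x: "x \<in> rspace V i" and y: "y \<in> rspace V i"
  shows "J i x y = of_int (vsign_cover S i) * J i y x"
proof -
  have "transpose_on (rspace V i) (J i) (double_dual s (rspace V i) y) =
      dual_scale (of_int (vsign_cover S i)) (J i y)"
    using symmetric i y by (simp add: symmetric_rep_def signed_form_def)
  from fun_cong[OF this, of x] show ?thesis
    using x J_functional(1)[OF i(1) x] i(2) by (simp add: transpose_on_def double_dual_def dual_scale_def)
qed

text \<open>
  The constant is \<open>1\<close> at a vertex moved by \<open>*\<close> and \<open>\<sigma>(i)\<close> at a fixed vertex. Merging the two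
  cases spares a case distinction when adjoints are taken twice.
\<close>
lemma J_symmetric:
  assumes i: "i \<in> verts Q"
  obtains \<epsilon> where "\<And>x y. x \<in> rspace V i \<Longrightarrow> y \<in> rspace V (vstar S i) \<Longrightarrow>
    J i x y = \<epsilon> * J (vstar S i) y x"
proof (cases "vstar S i = i")
  case True
  then show ?thesis using J_symmetric_fixed[OF i] that by metis
next
  case False
  then show ?thesis using J_symmetric_moved[OF i] that[of 1] by simp
qed

text \<open>
  The statement that \<open>J\<close> is a morphism to the dual representation, read as a rule for
  moving an arrow from the left to the right argument of the form.
\<close>
lemma J_rmap:
  assumes e: "e \<in> arcs Q" and x: "x \<in> rspace V (tail Q e)"
    and y: "y \<in> rspace V (vstar S (head Q e))"
  shows "J (head Q e) (rmap V e x) y = of_int (dual_sign S e) * J (tail Q e) x (rmap V (astar S e) y)"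
proof -
  have "J (head Q e) (rmap V e x) = rmap (dual_rep s S V) e (J (tail Q e) x)"
    using symmetric e x by (simp add: symmetric_rep_def rep_iso_map_def)
  then show ?thesis
    using y sq.astar_arc[OF e] by (simp add: dual_rep_def dual_scale_def transpose_on_def)
qed

lemma rmap_star_closed:
  "e \<in> arcs Q \<Longrightarrow> y \<in> rspace V (vstar S (head Q e)) \<Longrightarrow>
    rmap V (astar S e) y \<in> rspace V (vstar S (tail Q e))"
  using rmap_closed[of "astar S e" y] sq.astar_arc[of e] by simp

lemma endo_rmap_star:
  assumes "rep_endo s Q V f" "e \<in> arcs Q" "y \<in> rspace V (vstar S (head Q e))"
  shows "f (vstar S (tail Q e)) (rmap V (astar S e) y) = rmap V (astar S e) (f (vstar S (head Q e)) y)"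
  using rep_endoD(3)[OF assms(1), of "astar S e" y] sq.astar_arc[OF assms(2)] assms(3) by simp

text \<open>
  \<open>g\<close> is the adjoint of \<open>f\<close>. The form pairs \<open>V(i)\<close> with \<open>V(i\<^sup>*)\<close>, so \<open>g\<close> at \<open>i\<close> is
  governed by \<open>f\<close> at \<open>i\<^sup>*\<close>.
\<close>
definition adjoint :: "('a cover \<Rightarrow> 'v \<Rightarrow> 'v) \<Rightarrow> ('a cover \<Rightarrow> 'v \<Rightarrow> 'v) \<Rightarrow> bool" where
  "adjoint f g \<longleftrightarrow> (\<forall>i\<in>verts Q. \<forall>x\<in>rspace V i. \<forall>y\<in>rspace V (vstar S i).
     J i (g i x) y = J i x (f (vstar S i) y))"

lemma adjointD:
  "adjoint f g \<Longrightarrow> i \<in> verts Q \<Longrightarrow> x \<in> rspace V i \<Longrightarrow> y \<in> rspace V (vstar S i) \<Longrightarrow>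
    J i (g i x) y = J i x (f (vstar S i) y)"
  by (simp add: adjoint_def)

text \<open>
  Swapping the arguments of the form twice, once before and once after moving the
  endomorphism across, multiplies by the same constant on both sides.
\<close>
lemma adjoint_sym:
  assumes f: "rep_endo s Q V f" and g: "rep_endo s Q V g" and adj: "adjoint f g"
  shows "adjoint g f"
  unfolding adjoint_def
proof (intro ballI)
  fix i x y assume i: "i \<in> verts Q" and x: "x \<in> rspace V i" and y: "y \<in> rspace V (vstar S i)"
  obtain \<epsilon> where \<epsilon>: "\<And>x y. x \<in> rspace V i \<Longrightarrow> y \<in> rspace V (vstar S i) \<Longrightarrow>
    J i x y = \<epsilon> * J (vstar S i) y x"
    using J_symmetric[OF i] by blast
  have "J i x (g (vstar S i) y) = \<epsilon> * J (vstar S i) (g (vstar S i) y) x"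
    using \<epsilon> x rep_endoD(2)[OF g star_verts[OF i] y] by simp
  also have "\<dots> = \<epsilon> * J (vstar S i) y (f i x)"
    using adjointD[OF adj star_verts[OF i] y, of x] x i by simp
  also have "\<dots> = J i (f i x) y"
    using \<epsilon> y rep_endoD(2)[OF f i x] by simp
  finally show "J i (f i x) y = J i x (g (vstar S i) y)" by simp
qed

lemma adjoint_comp:
  assumes "adjoint f g" "adjoint f' g'" "rep_endo s Q V g" "rep_endo s Q V f'"
  shows "adjoint (\<lambda>i x. f i (f' i x)) (\<lambda>i x. g' i (g i x))"
  using assms rep_endoD(2) unfolding adjoint_def by (metis star_verts)

lemma adjoint_add:
  assumes "adjoint f g" "adjoint f' g'" "rep_endo s Q V f" "rep_endo s Q V f'"
    "rep_endo s Q V g" "rep_endo s Q V g'"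
  shows "adjoint (\<lambda>i x. f i x + f' i x) (\<lambda>i x. g i x + g' i x)"
  using assms(1,2) rep_endoD(2)[OF assms(3)] rep_endoD(2)[OF assms(4)]
    rep_endoD(2)[OF assms(5)] rep_endoD(2)[OF assms(6)]
  unfolding adjoint_def by (simp add: J_add_left J_add_right)

lemma adjoint_funpow:
  assumes f: "rep_endo s Q V f" and adj: "adjoint f f"
    and i: "i \<in> verts Q" and x: "x \<in> rspace V i" and y: "y \<in> rspace V (vstar S i)"
  shows "J i ((f i ^^ n) x) y = J i x ((f (vstar S i) ^^ n) y)"
  using y
proof (induction n arbitrary: y)
  case (Suc n)
  have "(f i ^^ n) x \<in> rspace V i"
    using linear_map_onD(1)[OF funpow_linear_map_on[OF rep_endoD(1)[OF f i]] x] .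
  then have "J i ((f i ^^ Suc n) x) y = J i ((f i ^^ n) x) (f (vstar S i) y)"
    using adjointD[OF adj i] Suc.prems by simp
  also have "\<dots> = J i x ((f (vstar S i) ^^ Suc n) y)"
    using Suc.IH[of "f (vstar S i) y"] rep_endoD(2)[OF f star_verts[OF i] Suc.prems]
    by (simp add: funpow_swap1)
  finally show ?case .
qed simp

text \<open>
  At \<open>i\<close> the adjoint is the transpose of \<open>f\<close> at \<open>i\<^sup>*\<close>, transported along the bijection \<open>J i\<close>.
  It commutes with an arrow \<open>\<phi>\<close> because \<open>f\<close> commutes with \<open>\<phi>\<^sup>*\<close>: moving \<open>\<phi>\<close> across the form and
  back introduces the sign \<open>s\<^sub>\<phi>\<close> on both sides.
\<close>
lemma adjoint_exists:
  assumes f: "rep_endo s Q V f"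
  obtains g where "rep_endo s Q V g" "adjoint f g"
proof -
  have "\<exists>z\<in>rspace V i. \<forall>y\<in>rspace V (vstar S i). J i z y = J i x (f (vstar S i) y)"
    if i: "i \<in> verts Q" and x: "x \<in> rspace V i" for i x
  proof -
    let ?g = "transpose_on (rspace V (vstar S i)) (f (vstar S i)) (J i x)"
    have "?g \<in> dual_space s (rspace V (vstar S i))"
      by (rule dual_space_transpose[OF rep_endoD(1)[OF f star_verts[OF i]]
            subspace_rspace[OF star_verts[OF i]] J_functional(1)[OF i x]])
    then obtain z where "z \<in> rspace V i" "J i z = ?g" by (rule J_onto[OF i])
    then show ?thesis by (intro bexI[of _ z]) (simp_all add: transpose_on_def)
  qed
  then obtain g where gV: "\<And>i x. i \<in> verts Q \<Longrightarrow> x \<in> rspace V i \<Longrightarrow> g i x \<in> rspace V i"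
    and g: "\<And>i x y. i \<in> verts Q \<Longrightarrow> x \<in> rspace V i \<Longrightarrow> y \<in> rspace V (vstar S i) \<Longrightarrow>
      J i (g i x) y = J i x (f (vstar S i) y)"
    by metis
  have "rep_endo s Q V g"
    unfolding rep_endo_def
  proof (intro conjI ballI)
    fix i assume i: "i \<in> verts Q"
    note V = subspace_rspace[OF i]
    note fV = rep_endoD(2)[OF f star_verts[OF i]]
    show "linear_map_on s s (rspace V i) (rspace V i) (g i)"
    proof (rule linear_map_onI)
      fix x y assume x: "x \<in> rspace V i" and y: "y \<in> rspace V i"
      show "g i (x + y) = g i x + g i y"
        by (rule J_eqI[OF i]) (simp_all add: gV g i x y fV subspace_add[OF V] J_add_left)
    next
      fix c x assume x: "x \<in> rspace V i"
      show "g i (s c x) = s c (g i x)"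
        by (rule J_eqI[OF i]) (simp_all add: gV g i x fV subspace_scale[OF V] J_scale_left)
    qed (rule gV[OF i])
  next
    fix e x assume e: "e \<in> arcs Q" and x: "x \<in> rspace V (tail Q e)"
    let ?t = "tail Q e" and ?h = "head Q e"
    have t: "?t \<in> verts Q" and h: "?h \<in> verts Q" using e by simp_all
    show "g ?h (rmap V e x) = rmap V e (g ?t x)"
    proof (rule J_eqI[OF h])
      fix y assume y: "y \<in> rspace V (vstar S ?h)"
      note fy = rep_endoD(2)[OF f star_verts[OF h] y]
      have "J ?h (g ?h (rmap V e x)) y = J ?h (rmap V e x) (f (vstar S ?h) y)"
        using g[OF h rmap_closed[OF e x] y] .
      also have "\<dots> = of_int (dual_sign S e) * J ?t x (f (vstar S ?t) (rmap V (astar S e) y))"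
        using J_rmap[OF e x fy] endo_rmap_star[OF f e y] by simp
      also have "\<dots> = of_int (dual_sign S e) * J ?t (g ?t x) (rmap V (astar S e) y)"
        using g[OF t x rmap_star_closed[OF e y]] by simp
      also have "\<dots> = J ?h (rmap V e (g ?t x)) y"
        using J_rmap[OF e gV[OF t x] y] by simp
      finally show "J ?h (g ?h (rmap V e x)) y = J ?h (rmap V e (g ?t x)) y" .
    qed (use gV[OF h rmap_closed[OF e x]] rmap_closed[OF e gV[OF t x]] in simp_all)
  qed
  moreover have "adjoint f g" using g by (simp add: adjoint_def)
  ultimately show thesis by (rule that)
qed

section \<open>Orthogonal splittings\<close>

text \<open>
  The left argument ranges over all of \<open>V(i)\<close>, not only over the image of \<open>p\<close>: with arguments in
  the image this is the form induced on \<open>pV\<close>, and in general it is the morphism from \<open>V\<close> to the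
  dual representation of \<open>pV\<close> that restricts the functional of each element to \<open>pV\<close>.
\<close>
definition restricted_form :: "('a cover \<Rightarrow> 'v \<Rightarrow> 'v) \<Rightarrow> 'a cover \<Rightarrow> 'v \<Rightarrow> 'v \<Rightarrow> 'k" where
  "restricted_form p i x = (\<lambda>y. if y \<in> p (vstar S i) ` rspace V (vstar S i) then J i x y else 0)"

lemma restricted_form_dual:
  assumes p: "rep_endo s Q V p" and i: "i \<in> verts Q" and x: "x \<in> rspace V i"
  shows "restricted_form p i x \<in> dual_space s (p (vstar S i) ` rspace V (vstar S i))"
proof -
  let ?X = "p (vstar S i) ` rspace V (vstar S i)"
  note i' = star_verts[OF i]
  have "linear_map_on s s ?X (rspace V (vstar S i)) (\<lambda>y. y)"
    using rep_endoD(2)[OF p i'] by (auto simp: linear_map_on_def)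
  from dual_space_transpose[OF this subspace_linear_image_on[OF rep_endoD(1)[OF p i'] subspace_rspace[OF i']]
      J_functional(1)[OF i x]]
  show ?thesis by (simp add: transpose_on_def restricted_form_def)
qed

lemma restricted_form_linear:
  assumes "i \<in> verts Q"
  shows "x \<in> rspace V i \<Longrightarrow> x' \<in> rspace V i \<Longrightarrow>
      restricted_form p i (x + x') = restricted_form p i x + restricted_form p i x'"
    and "x \<in> rspace V i \<Longrightarrow> restricted_form p i (s c x) = dual_scale c (restricted_form p i x)"
  using assms by (simp_all add: fun_eq_iff restricted_form_def dual_scale_def J_add_left J_scale_left)

lemma restricted_form_rmap:
  assumes p: "rep_endo s Q V p" and e: "e \<in> arcs Q" and x: "x \<in> rspace V (tail Q e)"
  shows "restricted_form p (head Q e) (rmap V e x) =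
    rmap (dual_rep s S (rep_image V p)) e (restricted_form p (tail Q e) x)"
proof
  fix y
  let ?t = "tail Q e" and ?h = "head Q e"
  have h: "?h \<in> verts Q" using e by simp
  show "restricted_form p ?h (rmap V e x) y =
    rmap (dual_rep s S (rep_image V p)) e (restricted_form p ?t x) y"
  proof (cases "y \<in> p (vstar S ?h) ` rspace V (vstar S ?h)")
    case True
    then obtain z where z: "z \<in> rspace V (vstar S ?h)" "y = p (vstar S ?h) z" by blast
    have "rmap V (astar S e) y \<in> p (vstar S ?t) ` rspace V (vstar S ?t)"
      using endo_rmap_star[OF p e z(1)] rmap_star_closed[OF e z(1)] z(2) by (metis imageI)
    moreover have "y \<in> rspace V (vstar S ?h)"
      using rep_endoD(2)[OF p star_verts[OF h] z(1)] z(2) by simp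
    ultimately show ?thesis
      using True J_rmap[OF e x, of y] sq.astar_arc[OF e]
      by (simp add: restricted_form_def dual_rep_def dual_scale_def transpose_on_def)
  next
    case False
    then show ?thesis
      using sq.astar_arc[OF e]
      by (simp add: restricted_form_def dual_rep_def dual_scale_def transpose_on_def)
  qed
qed

text \<open>
  The form stays perfect on the image of \<open>p\<close>: for \<open>x \<in> pV\<close> we have \<open>\<langle>x, y\<rangle> = \<langle>x, p y\<rangle>\<close>, so \<open>x\<close> is
  determined by its pairing with \<open>pV\<close>, and a functional on \<open>pV\<close> that is represented on \<open>V\<close>
  (after composition with \<open>p\<close>) by \<open>z\<close> is represented by \<open>p z\<close>.
\<close>
lemma symmetric_rep_image:
  assumes p: "idempotent_endo s Q V p" and adj: "adjoint p p"
  shows "symmetric_rep s S (rep_image V p) (restricted_form p)"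
proof -
  have endo: "rep_endo s Q V p" using p by (simp add: idempotent_endo_def)
  have pp: "p i (p i x) = p i x" if "i \<in> verts Q" "x \<in> rspace V i" for i x
    using p that by (simp add: idempotent_endo_def)
  note pV = rep_endoD(2)[OF endo]
  let ?X = "\<lambda>i. p i ` rspace V i"
  have XV: "x \<in> rspace V i" if "i \<in> verts Q" "x \<in> ?X i" for i x
    using that pV by auto
  have X_iff: "x \<in> ?X i \<longleftrightarrow> x \<in> rspace V i \<and> p i x = x" if "i \<in> verts Q" for i x
  proof
    assume "x \<in> ?X i"
    then show "x \<in> rspace V i \<and> p i x = x" using pV[OF that] pp[OF that] by auto
  next
    assume "x \<in> rspace V i \<and> p i x = x"
    then show "x \<in> ?X i" by (intro image_eqI[of _ _ x]) simp_all
  qed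
  note J_X = restricted_form_dual[OF endo _ XV]
  have lin: "linear_map_on s dual_scale (?X i) (dual_space s (?X (vstar S i))) (restricted_form p i)"
    if i: "i \<in> verts Q" for i
    by (rule linear_map_onI)
      (use J_X[OF i i] restricted_form_linear[OF i] XV[OF i] in simp_all)
  have bij: "bij_betw (restricted_form p i) (?X i) (dual_space s (?X (vstar S i)))"
    if i: "i \<in> verts Q" for i
    unfolding bij_betw_def
  proof (intro conjI inj_onI subset_antisym subsetI)
    fix x x' assume x: "x \<in> ?X i" "x' \<in> ?X i" and eq: "restricted_form p i x = restricted_form p i x'"
    show "x = x'"
    proof (rule J_eqI[OF i XV[OF i x(1)] XV[OF i x(2)]])
      fix y assume y: "y \<in> rspace V (vstar S i)"
      have "J i z y = restricted_form p i z (p (vstar S i) y)" if "z \<in> ?X i" for z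
        using adjointD[OF adj i XV[OF i that] y] that X_iff[OF i] y by (simp add: restricted_form_def)
      then show "J i x y = J i x' y" using x eq by simp
    qed
  next
    fix g assume g: "g \<in> dual_space s (?X (vstar S i))"
    note i' = star_verts[OF i]
    let ?g = "transpose_on (rspace V (vstar S i)) (p (vstar S i)) g"
    have "?g \<in> dual_space s (rspace V (vstar S i))"
      by (rule dual_space_transpose[OF linear_map_on_image[OF rep_endoD(1)[OF endo i']]
            subspace_rspace[OF i'] g])
    then obtain z where z: "z \<in> rspace V i" "J i z = ?g" by (rule J_onto[OF i])
    have "restricted_form p i (p i z) y = g y" for y
    proof (cases "y \<in> ?X (vstar S i)")
      case True
      then have y: "y \<in> rspace V (vstar S i)" "p (vstar S i) y = y" using X_iff[OF i'] by auto
      then show ?thesis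
        using adjointD[OF adj i z(1) y(1)] True z(2) by (simp add: restricted_form_def transpose_on_def)
    qed (use g in \<open>simp add: restricted_form_def dual_space_def\<close>)
    then have "restricted_form p i (p i z) = g" by blast
    then show "g \<in> restricted_form p i ` ?X i" using z(1) by blast
  qed (use J_X[OF i i] in blast)
  have "signed_form s S ?X (restricted_form p)"
    unfolding signed_form_def
  proof (intro ballI conjI impI ext)
    fix i y x assume i: "i \<in> verts Q" and ne: "vstar S i \<noteq> i" and y: "y \<in> ?X (vstar S i)"
    show "restricted_form p (vstar S i) y x =
        transpose_on (?X i) (restricted_form p i) (double_dual s (?X (vstar S i)) y) x"
      using J_X[OF i i, of x] J_symmetric_moved[OF i ne _ XV[OF star_verts[OF i] y], of x] XV[OF i, of x] y i
      by (simp add: transpose_on_def double_dual_def restricted_form_def)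
  next
    fix i y x assume i: "i \<in> verts Q" and fixed: "vstar S i = i" and y: "y \<in> ?X i"
    show "transpose_on (?X i) (restricted_form p i) (double_dual s (?X i) y) x =
        dual_scale (of_int (vsign_cover S i)) (restricted_form p i y) x"
      using J_X[OF i i, of x] J_symmetric_fixed[OF i fixed _ XV[OF i y], of x] XV[OF i, of x] y fixed
      by (simp add: transpose_on_def double_dual_def restricted_form_def dual_scale_def)
  qed (use lin bij in simp_all)
  moreover have "rep_iso_map s dual_scale Q (rep_image V p) (dual_rep s S (rep_image V p)) (restricted_form p)"
    unfolding rep_iso_map_def
  proof (intro conjI ballI)
    fix e x assume e: "e \<in> arcs Q" and x: "x \<in> rspace (rep_image V p) (tail Q e)"
    show "restricted_form p (head Q e) (rmap (rep_image V p) e x) =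
        rmap (dual_rep s S (rep_image V p)) e (restricted_form p (tail Q e) x)"
      using restricted_form_rmap[OF endo e XV] e x by simp
  qed (use lin bij in \<open>simp_all add: dual_rep_def\<close>)
  ultimately show ?thesis
    using is_rep_image[OF endo] by (simp add: symmetric_rep_def rep_image_def)
qed

lemma selfadjoint_complement:
  assumes p: "rep_endo s Q V p" and adj: "adjoint p p"
  shows "adjoint (\<lambda>i x. x - p i x) (\<lambda>i x. x - p i x)"
  unfolding adjoint_def
proof (intro ballI)
  fix i x y assume i: "i \<in> verts Q" and x: "x \<in> rspace V i" and y: "y \<in> rspace V (vstar S i)"
  have "J i (x - p i x) y = J i x y - J i (p i x) y"
    using linear_map_on_diff[OF J_linear[OF i] subspace_rspace[OF i] x rep_endoD(2)[OF p i x]]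
    by simp
  also have "\<dots> = J i x (y - p (vstar S i) y)"
    using linear_map_on_diff[OF J_functional(2)[OF i x] subspace_rspace[OF star_verts[OF i]] y
        rep_endoD(2)[OF p star_verts[OF i] y]] adjointD[OF adj i x y] by simp
  finally show "J i (x - p i x) y = J i x (y - p (vstar S i) y)" .
qed

text \<open>
  For self-adjoint \<open>p\<close> the images of \<open>p\<close> and \<open>q = 1 - p\<close> are orthogonal, since
  \<open>\<langle>p x, q y\<rangle> = \<langle>x, p (q y)\<rangle> = 0\<close>. So \<open>x \<mapsto> (p x, q x)\<close> is an isomorphism of symmetric representations
  from \<open>V\<close> to \<open>pV \<oplus> qV\<close>, and indecomposability forces one of the summands to vanish.
\<close>
lemma selfadjoint_idempotent_trivial:
  assumes indec: "indecomposable_symmetric_rep s S V J"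
    and p: "idempotent_endo s Q V p" and adj: "adjoint p p"
  shows "(\<forall>i\<in>verts Q. \<forall>x\<in>rspace V i. p i x = 0) \<or> (\<forall>i\<in>verts Q. \<forall>x\<in>rspace V i. p i x = x)"
proof (rule ccontr)
  assume contr: "\<not> ?thesis"
  have endo: "rep_endo s Q V p" using p by (simp add: idempotent_endo_def)
  note pV = rep_endoD(2)[OF endo]
  define q where "q i x = x - p i x" for i x
  have q: "idempotent_endo s Q V q" and adj_q: "adjoint q q"
    using idempotent_complement[OF p] selfadjoint_complement[OF endo adj]
    by (simp_all add: q_def[abs_def])
  have endo_q: "rep_endo s Q V q" using q by (simp add: idempotent_endo_def)
  note qV = rep_endoD(2)[OF endo_q]
  have pp: "p i (p i x) = p i x" and qq: "q i (q i x) = q i x"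
    if "i \<in> verts Q" "x \<in> rspace V i" for i x
    using p q that by (simp_all add: idempotent_endo_def)
  let ?A = "rep_image V p" and ?B = "rep_image V q"
  let ?f = "\<lambda>i x. (p i x, q i x)"
  obtain i x j y where "i \<in> verts Q" "x \<in> rspace V i" "p i x \<noteq> 0"
    and "j \<in> verts Q" "y \<in> rspace V j" "q j y \<noteq> 0"
    using contr unfolding q_def by (metis right_minus_eq)
  then have "nonzero_rep Q ?A" "nonzero_rep Q ?B"
    by (auto intro: nonzero_rep_imageI)
  moreover have "symmetric_rep_iso s (module_prod.scale s s) S V J (rep_sum ?A ?B)
    (form_sum S ?A (restricted_form p) ?B (restricted_form q))"
    unfolding symmetric_rep_iso_def
  proof (intro exI[of _ ?f] conjI)
    show "rep_iso_map s (module_prod.scale s s) Q V (rep_sum ?A ?B) ?f"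
      unfolding rep_iso_map_def
    proof (intro conjI ballI)
      fix i assume i: "i \<in> verts Q"
      show "linear_map_on s (module_prod.scale s s) (rspace V i) (rspace (rep_sum ?A ?B) i) (?f i)"
        by (rule linear_map_onI)
          (simp_all add: rep_sum_def module_prod_scale_apply[OF module_axioms module_axioms]
            linear_map_onD[OF rep_endoD(1)[OF endo i]] linear_map_onD[OF rep_endoD(1)[OF endo_q i]])
      show "bij_betw (?f i) (rspace V i) (rspace (rep_sum ?A ?B) i)"
        unfolding bij_betw_def
      proof (intro conjI inj_onI subset_antisym subsetI)
        fix x y assume "(p i x, q i x) = (p i y, q i y)"
        then have "p i x + q i x = p i y + q i y" by simp
        then show "x = y" by (simp add: q_def)
      next
        fix ab assume "ab \<in> rspace (rep_sum ?A ?B) i"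
        then obtain x y where xy: "x \<in> rspace V i" "y \<in> rspace V i" "ab = (p i x, q i y)"
          by (auto simp: rep_sum_def)
        let ?z = "p i x + q i y"
        have z: "?z \<in> rspace V i"
          using subspace_add[OF subspace_rspace[OF i]] pV[OF i] qV[OF i] xy by simp
        have "p i (q i y) = 0" using qq[OF i xy(2)] by (simp add: q_def)
        then have "p i ?z = p i x"
          using linear_map_onD(2)[OF rep_endoD(1)[OF endo i] pV[OF i xy(1)] qV[OF i xy(2)]]
            pp[OF i xy(1)] by simp
        then have "?f i ?z = ab" using xy(3) by (simp add: q_def)
        then show "ab \<in> ?f i ` rspace V i" using z by blast
      qed (auto simp: rep_sum_def)
    next
      fix e x assume "e \<in> arcs Q" "x \<in> rspace V (tail Q e)"
      then show "?f (head Q e) (rmap V e x) = rmap (rep_sum ?A ?B) e (?f (tail Q e) x)"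
        using rep_endoD(3)[OF endo] rep_endoD(3)[OF endo_q] by (simp add: rep_sum_def)
    qed
  next
    show "\<forall>i\<in>verts Q. \<forall>x\<in>rspace V i. J i x =
      transpose_on (rspace V (vstar S i)) (?f (vstar S i))
        (form_sum S ?A (restricted_form p) ?B (restricted_form q) i (?f i x))"
    proof (intro ballI ext)
      fix i x y assume i: "i \<in> verts Q" and x: "x \<in> rspace V i"
      note i' = star_verts[OF i]
      show "J i x y = transpose_on (rspace V (vstar S i)) (?f (vstar S i))
        (form_sum S ?A (restricted_form p) ?B (restricted_form q) i (?f i x)) y"
      proof (cases "y \<in> rspace V (vstar S i)")
        case True
        have "J i x y = J i x (p (vstar S i) y) + J i x (q (vstar S i) y)"
          using J_add_right[OF i x pV[OF i' True] qV[OF i' True]] by (simp add: q_def)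
        also have "\<dots> = J i (p i x) (p (vstar S i) y) + J i (q i x) (q (vstar S i) y)"
          using adjointD[OF adj i x pV[OF i' True]] adjointD[OF adj_q i x qV[OF i' True]]
            pp[OF i' True] qq[OF i' True] by simp
        finally show ?thesis
          using True by (simp add: transpose_on_def form_sum_def restricted_form_def)
      next
        case False
        then show ?thesis using J_functional(3)[OF i x] by (simp add: transpose_on_def)
      qed
    qed
  qed
  ultimately show False
    using indec symmetric_rep_image[OF p adj] symmetric_rep_image[OF q adj_q]
    unfolding indecomposable_symmetric_rep_def by blast
qed

text \<open>
  A common large power \<open>F\<close> of \<open>f\<close> splits every \<open>V(i)\<close> into the image and the kernel of \<open>F\<close>.
  The projection \<open>p\<close> onto the image is canonical, hence a self-adjoint endomorphism of \<open>V\<close>.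
  It is \<open>0\<close> exactly when \<open>F = 0\<close>, and when it is \<open>1\<close> then \<open>F\<close>, and with it \<open>f\<close>, is bijective.
\<close>
lemma selfadjoint_nilpotent_or_bijective:
  assumes indec: "indecomposable_symmetric_rep s S V J"
    and f: "rep_endo s Q V f" and adj: "adjoint f f"
  shows "(\<exists>n. \<forall>i\<in>verts Q. \<forall>x\<in>rspace V i. (f i ^^ n) x = 0) \<or>
    (\<forall>i\<in>verts Q. bij_betw (f i) (rspace V i) (rspace V i))"
proof -
  obtain N where N: "\<And>i n. i \<in> verts Q \<Longrightarrow> N i \<le> n \<Longrightarrow>
      (\<forall>a\<in>rspace V i. (f i ^^ n) ((f i ^^ n) a) = 0 \<longrightarrow> (f i ^^ n) a = 0) \<and>
      (\<forall>x\<in>rspace V i. \<exists>a\<in>rspace V i. (f i ^^ n) (x - (f i ^^ n) a) = 0)"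
    using fitting[OF fin_dim rep_endoD(1)[OF f]] by metis
  \<comment> \<open>The successor makes \<open>F\<close> factor through \<open>f\<close>, so that bijectivity of \<open>F\<close> passes to \<open>f\<close>.\<close>
  define n where "n = Suc (\<Sum>i\<in>verts Q. N i)"
  define F where "F i = f i ^^ n" for i
  have n: "N i \<le> n" if "i \<in> verts Q" for i
    using member_le_sum[of i "verts Q" N] that by (simp add: n_def)
  have ker_im: "F i a = 0" if "i \<in> verts Q" "a \<in> rspace V i" "F i (F i a) = 0" for i a
    using N[OF that(1) n[OF that(1)]] that(2,3) by (simp add: F_def)
  have F_lin: "linear_map_on s s (rspace V i) (rspace V i) (F i)" if "i \<in> verts Q" for i
    unfolding F_def by (rule funpow_linear_map_on[OF rep_endoD(1)[OF f that]])
  note FV = linear_map_onD(1)[OF F_lin]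
  have f_rmap: "(f (head Q e) ^^ m) (rmap V e x) = rmap V e ((f (tail Q e) ^^ m) x)"
    if e: "e \<in> arcs Q" and x: "x \<in> rspace V (tail Q e)" for e x m
  proof (induction m)
    case (Suc m)
    have "(f (tail Q e) ^^ m) x \<in> rspace V (tail Q e)"
      by (rule linear_map_onD(1)[OF funpow_linear_map_on[OF rep_endoD(1)[OF f]]]) (use e x in simp_all)
    then show ?case using Suc rep_endoD(3)[OF f e] by simp
  qed simp
  have F_endo: "rep_endo s Q V F"
    using F_lin f_rmap by (simp add: rep_endo_def F_def)
  have F_adj: "adjoint F F"
    using adjoint_funpow[OF f adj] by (simp add: adjoint_def F_def)
  have "\<exists>a\<in>rspace V i. F i (x - F i a) = 0" if "i \<in> verts Q" "x \<in> rspace V i" for i x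
    using N[OF that(1) n[OF that(1)]] that(2) by (simp add: F_def)
  then obtain c where cV: "\<And>i x. i \<in> verts Q \<Longrightarrow> x \<in> rspace V i \<Longrightarrow> c i x \<in> rspace V i"
    and c: "\<And>i x. i \<in> verts Q \<Longrightarrow> x \<in> rspace V i \<Longrightarrow> F i (x - F i (c i x)) = 0"
    by metis
  \<comment> \<open>The choice \<open>c\<close> need not be linear, but \<open>p\<close> does not depend on it: \<open>p_eqI\<close> characterizes \<open>p i x\<close>
    as the only element of the image with the same value under \<open>F\<close> as \<open>x\<close>.\<close>
  define p where "p i x = F i (c i x)" for i x
  have pV: "p i x \<in> rspace V i" if "i \<in> verts Q" "x \<in> rspace V i" for i x
    using FV cV that by (simp add: p_def)
  have Fp: "F i (p i x) = F i x" if i: "i \<in> verts Q" and x: "x \<in> rspace V i" for i x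
    using c[OF i x] linear_map_on_diff[OF F_lin[OF i] subspace_rspace[OF i] x pV[OF i x]]
    by (simp add: p_def)
  have p_eqI: "p i x = F i a"
    if i: "i \<in> verts Q" and x: "x \<in> rspace V i" and a: "a \<in> rspace V i" and eq: "F i x = F i (F i a)"
    for i x a
  proof -
    note V = subspace_rspace[OF i]
    have d: "c i x - a \<in> rspace V i" using subspace_diff[OF V cV[OF i x] a] .
    have Fd: "F i (c i x - a) = p i x - F i a"
      using linear_map_on_diff[OF F_lin[OF i] V cV[OF i x] a] by (simp add: p_def)
    have "F i (p i x - F i a) = 0"
      using linear_map_on_diff[OF F_lin[OF i] V pV[OF i x] FV[OF i a]] Fp[OF i x] eq by simp
    then show ?thesis using ker_im[OF i d] Fd by simp
  qed
  have p_endo: "rep_endo s Q V p"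
    unfolding rep_endo_def
  proof (intro conjI ballI)
    fix i assume i: "i \<in> verts Q"
    note V = subspace_rspace[OF i]
    note lin = linear_map_onD(2,3)[OF F_lin[OF i]]
    show "linear_map_on s s (rspace V i) (rspace V i) (p i)"
    proof (rule linear_map_onI)
      fix x y assume x: "x \<in> rspace V i" and y: "y \<in> rspace V i"
      have "p i (x + y) = F i (c i x + c i y)"
        by (rule p_eqI[OF i])
          (use Fp[OF i] in \<open>simp_all add: p_def x y lin subspace_add[OF V] cV[OF i] FV[OF i]\<close>)
      then show "p i (x + y) = p i x + p i y" by (simp add: p_def lin cV[OF i] x y)
    next
      fix k x assume x: "x \<in> rspace V i"
      have "p i (s k x) = F i (s k (c i x))"
        by (rule p_eqI[OF i])
          (use Fp[OF i] in \<open>simp_all add: p_def x lin subspace_scale[OF V] cV[OF i] FV[OF i]\<close>)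
      then show "p i (s k x) = s k (p i x)" by (simp add: p_def lin cV[OF i] x)
    qed (rule pV[OF i])
  next
    fix e x assume e: "e \<in> arcs Q" and x: "x \<in> rspace V (tail Q e)"
    have t: "tail Q e \<in> verts Q" and h: "head Q e \<in> verts Q" using e by simp_all
    note Fe = rep_endoD(3)[OF F_endo e]
    have "p (head Q e) (rmap V e x) = F (head Q e) (rmap V e (c (tail Q e) x))"
      by (rule p_eqI[OF h])
        (use Fp[OF t x] in \<open>simp_all add: p_def rmap_closed e x cV[OF t] FV[OF t] Fe\<close>)
    then show "p (head Q e) (rmap V e x) = rmap V e (p (tail Q e) x)"
      by (simp add: p_def Fe cV[OF t x])
  qed
  have "p i (p i x) = p i x" if i: "i \<in> verts Q" and x: "x \<in> rspace V i" for i x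
    using p_eqI[OF i pV[OF i x] cV[OF i x]] by (simp add: p_def)
  then have p: "idempotent_endo s Q V p" using p_endo by (simp add: idempotent_endo_def)
  have "adjoint p p"
    unfolding adjoint_def
  proof (intro ballI)
    fix i x y assume i: "i \<in> verts Q" and x: "x \<in> rspace V i" and y: "y \<in> rspace V (vstar S i)"
    note i' = star_verts[OF i]
    have "J i (p i x) y = J i (c i x) (F (vstar S i) (p (vstar S i) y))"
      using adjointD[OF F_adj i cV[OF i x] y] Fp[OF i' y] by (simp add: p_def)
    also have "\<dots> = J i (F i (p i x)) (c (vstar S i) y)"
      using adjointD[OF F_adj i cV[OF i x] pV[OF i' y]]
        adjointD[OF F_adj i pV[OF i x] cV[OF i' y]] by (simp add: p_def)
    also have "\<dots> = J i x (p (vstar S i) y)"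
      using adjointD[OF F_adj i x cV[OF i' y]] Fp[OF i x] by (simp add: p_def)
    finally show "J i (p i x) y = J i x (p (vstar S i) y)" .
  qed
  from selfadjoint_idempotent_trivial[OF indec p this] show ?thesis
  proof
    assume 0: "\<forall>i\<in>verts Q. \<forall>x\<in>rspace V i. p i x = 0"
    have "(f i ^^ n) x = 0" if i: "i \<in> verts Q" and x: "x \<in> rspace V i" for i x
    proof -
      have "F i x = F i 0" using Fp[OF i x] 0 i x by simp
      then show ?thesis using linear_map_on_zero[OF F_lin[OF i] subspace_rspace[OF i]] by (simp add: F_def)
    qed
    then show ?thesis by blast
  next
    assume 1: "\<forall>i\<in>verts Q. \<forall>x\<in>rspace V i. p i x = x"
    have "bij_betw (f i) (rspace V i) (rspace V i)" if i: "i \<in> verts Q" for i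
      unfolding bij_betw_def
    proof (intro conjI inj_onI subset_antisym subsetI)
      fix x y assume x: "x \<in> rspace V i" and y: "y \<in> rspace V i" and eq: "f i x = f i y"
      have "F i x = F i y" using eq by (simp add: F_def n_def funpow_swap1)
      then have "p i x = p i y"
        using p_eqI[OF i x cV[OF i y]] Fp[OF i y] by (simp add: p_def)
      then show "x = y" using 1 i x y by simp
    next
      fix x assume x: "x \<in> rspace V i"
      have "x = f i ((f i ^^ (\<Sum>i\<in>verts Q. N i)) (c i x))"
        using 1 i x by (simp add: p_def F_def n_def)
      moreover have "(f i ^^ (\<Sum>i\<in>verts Q. N i)) (c i x) \<in> rspace V i"
        using linear_map_onD(1)[OF funpow_linear_map_on[OF rep_endoD(1)[OF f i]] cV[OF i x]] .
      ultimately show "x \<in> f i ` rspace V i" by blast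
    qed (use rep_endoD(2)[OF f i] in auto)
    then show ?thesis by blast
  qed
qed

section \<open>A proper idempotent and its adjoint\<close>

lemma adjoint_idempotent:
  assumes e: "idempotent_endo s Q V e" and adj: "adjoint e g" and g: "rep_endo s Q V g"
    and i: "i \<in> verts Q" and x: "x \<in> rspace V i"
  shows "g i (g i x) = g i x"
proof (rule J_eqI[OF i])
  note gV = rep_endoD(2)[OF g i]
  show "g i (g i x) \<in> rspace V i" "g i x \<in> rspace V i" using gV x by simp_all
  fix y assume y: "y \<in> rspace V (vstar S i)"
  have eV: "e (vstar S i) y \<in> rspace V (vstar S i)"
    and ee: "e (vstar S i) (e (vstar S i) y) = e (vstar S i) y"
    using e star_verts[OF i] y rep_endoD(2) by (auto simp: idempotent_endo_def)
  show "J i (g i (g i x)) y = J i (g i x) y"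
    using adjointD[OF adj i gV[OF x] y] adjointD[OF adj i x eV] adjointD[OF adj i x y] ee by simp
qed

end

text \<open>
  The situation when \<open>V\<close> is decomposable as a representation although it is indecomposable as a
  symmetric representation: \<open>e\<close> projects onto a proper summand and \<open>g\<close> is its adjoint.
\<close>
locale proper_idempotent = symmetric_representation s S V J
  for s :: "'k::field \<Rightarrow> 'v::ab_group_add \<Rightarrow> 'v" and S :: "('a, 'b) signed_quiver"
    and V :: "('a cover, 'b cover, 'v) rep" and J :: "'a cover \<Rightarrow> 'v \<Rightarrow> 'v \<Rightarrow> 'k" +
  fixes e g :: "'a cover \<Rightarrow> 'v \<Rightarrow> 'v"
  assumes indecomposable: "indecomposable_symmetric_rep s S V J"
    and idempotent: "idempotent_endo s Q V e"
    and nonzero: "\<exists>i\<in>verts Q. \<exists>x\<in>rspace V i. e i x \<noteq> 0"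
    and nonidentity: "\<exists>i\<in>verts Q. \<exists>x\<in>rspace V i. e i x \<noteq> x"
    and adjoint_endo: "rep_endo s Q V g"
    and adjoint: "adjoint e g"
begin

lemma endo: "rep_endo s Q V e"
  using idempotent by (simp add: idempotent_endo_def)

lemma closed: "i \<in> verts Q \<Longrightarrow> x \<in> rspace V i \<Longrightarrow> e i x \<in> rspace V i"
  and adjoint_closed: "i \<in> verts Q \<Longrightarrow> x \<in> rspace V i \<Longrightarrow> g i x \<in> rspace V i"
  using rep_endoD(2)[OF endo] rep_endoD(2)[OF adjoint_endo] by simp_all

lemma idem: "i \<in> verts Q \<Longrightarrow> x \<in> rspace V i \<Longrightarrow> e i (e i x) = e i x"
  using idempotent by (simp add: idempotent_endo_def)

lemma adjoint_idem: "i \<in> verts Q \<Longrightarrow> x \<in> rspace V i \<Longrightarrow> g i (g i x) = g i x"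
  using adjoint_idempotent[OF idempotent adjoint adjoint_endo] .

text \<open>
  The composition of \<open>e\<close> with its adjoint is self-adjoint and takes values in the proper summand
  \<open>eV\<close>. Not being surjective, it is nilpotent, and a nilpotent map fixes only \<open>0\<close>.
\<close>
lemma comp_adjoint_no_fixed_point:
  assumes i: "i \<in> verts Q" and x: "x \<in> rspace V i" and fixpt: "e i (g i x) = x"
  shows "x = 0"
proof -
  let ?h = "\<lambda>i x. e i (g i x)"
  have "rep_endo s Q V ?h" by (rule rep_endo_comp[OF endo adjoint_endo])
  moreover have "adjoint ?h ?h"
    by (rule adjoint_comp[OF adjoint adjoint_sym[OF endo adjoint_endo adjoint] adjoint_endo adjoint_endo])
  moreover have "\<not> (\<forall>i\<in>verts Q. bij_betw (?h i) (rspace V i) (rspace V i))"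
  proof
    assume bij: "\<forall>i\<in>verts Q. bij_betw (?h i) (rspace V i) (rspace V i)"
    obtain j y where j: "j \<in> verts Q" and y: "y \<in> rspace V j" "e j y \<noteq> y"
      using nonidentity by blast
    then have "y \<in> ?h j ` rspace V j" using bij by (simp add: bij_betw_def)
    then obtain z where "z \<in> rspace V j" "y = e j (g j z)" by blast
    then show False using idem[OF j adjoint_closed[OF j]] y(2) by simp
  qed
  ultimately obtain n where "(?h i ^^ n) x = 0"
    using selfadjoint_nilpotent_or_bijective[OF indecomposable, of ?h] i x by blast
  moreover have "(?h i ^^ n) x = x" using fixpt by (induction n) simp_all
  ultimately show "x = 0" by simp
qed

lemma images_disjoint:
  assumes "i \<in> verts Q" "x \<in> rspace V i" "e i x = x" "g i x = x"
  shows "x = 0"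
  using comp_adjoint_no_fixed_point[OF assms(1,2)] assms(3,4) by simp

text \<open>
  The sum \<open>e + g\<close> is self-adjoint, so it suffices that it is not nilpotent. It maps
  \<open>T = eV + gV\<close> to itself, and \<open>T \<noteq> 0\<close>; if \<open>z = e a + g b\<close> is killed, then \<open>e z = - g z\<close> lies in
  both images and vanishes, and the two equations \<open>e z = 0\<close> and \<open>g z = 0\<close> make \<open>e a\<close> a fixed
  point of \<open>e g\<close>, so \<open>e a = 0\<close> and \<open>g b = 0\<close>.
\<close>
lemma sum_bijective:
  assumes "i \<in> verts Q"
  shows "bij_betw (\<lambda>x. e i x + g i x) (rspace V i) (rspace V i)"
proof -
  let ?s = "\<lambda>i x. e i x + g i x"
  have "rep_endo s Q V ?s" by (rule rep_endo_add[OF endo adjoint_endo])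
  moreover have "adjoint ?s ?s"
  proof -
    have "adjoint ?s (\<lambda>i x. g i x + e i x)"
      by (rule adjoint_add[OF adjoint adjoint_sym[OF endo adjoint_endo adjoint] endo adjoint_endo
            adjoint_endo endo])
    then show ?thesis by (simp add: add.commute)
  qed
  moreover have "\<not> (\<exists>n. \<forall>i\<in>verts Q. \<forall>x\<in>rspace V i. (?s i ^^ n) x = 0)"
  proof
    assume "\<exists>n. \<forall>i\<in>verts Q. \<forall>x\<in>rspace V i. (?s i ^^ n) x = 0"
    then obtain n where n: "\<And>i x. i \<in> verts Q \<Longrightarrow> x \<in> rspace V i \<Longrightarrow> (?s i ^^ n) x = 0" by blast
    obtain j w where j: "j \<in> verts Q" and w: "w \<in> rspace V j" "e j w \<noteq> 0"
      using nonzero by blast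
    note V = subspace_rspace[OF j]
    note e_add = linear_map_onD(2)[OF rep_endoD(1)[OF endo j]]
    note g_add = linear_map_onD(2)[OF rep_endoD(1)[OF adjoint_endo j]]
    note e_zero = linear_map_on_zero[OF rep_endoD(1)[OF endo j] V]
    note g_zero = linear_map_on_zero[OF rep_endoD(1)[OF adjoint_endo j] V]
    note eV = closed[OF j] and gV = adjoint_closed[OF j]
    define T where "T = {e j a + g j b | a b. a \<in> rspace V j \<and> b \<in> rspace V j}"
    have inj: "z = 0" if zT: "z \<in> T" and sz: "?s j z = 0" for z
    proof -
      obtain a b where ab: "a \<in> rspace V j" "b \<in> rspace V j" and z: "z = e j a + g j b"
        using zT by (auto simp: T_def)
      have zV: "z \<in> rspace V j" using z ab eV gV subspace_add[OF V] by simp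
      have "g j (e j z) + g j (g j z) = 0"
        using g_add[OF eV[OF zV] gV[OF zV]] sz g_zero by simp
      then have "g j (e j z) = e j z"
        using adjoint_idem[OF j zV] sz by (metis add_right_cancel)
      then have ez: "e j z = 0"
        using images_disjoint[OF j eV[OF zV] idem[OF j zV]] by simp
      then have gz: "g j z = 0" using sz by simp
      have 1: "e j a + e j (g j b) = 0"
        using ez e_add[OF eV[OF ab(1)] gV[OF ab(2)]] idem[OF j ab(1)] z by simp
      have 2: "g j (e j a) + g j b = 0"
        using gz g_add[OF eV[OF ab(1)] gV[OF ab(2)]] adjoint_idem[OF j ab(2)] z by simp
      have "e j (g j (e j a)) + e j (g j b) = 0"
        using e_add[OF gV[OF eV[OF ab(1)]] gV[OF ab(2)]] 2 e_zero by simp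
      then have "e j (g j (e j a)) = e j a" using 1 by (metis add_right_cancel)
      then have "e j a = 0" using comp_adjoint_no_fixed_point[OF j eV[OF ab(1)]] by simp
      then show "z = 0" using 2 g_zero z by simp
    qed
    have "(?s j ^^ m) (e j w) \<in> T \<and> (?s j ^^ m) (e j w) \<noteq> 0" for m
    proof (induction m)
      case 0
      have "e j w = e j w + g j 0" using g_zero by simp
      then have "e j w \<in> T" using w(1) subspace_0[OF V] unfolding T_def by blast
      then show ?case using w(2) by simp
    next
      case (Suc m)
      let ?z = "(?s j ^^ m) (e j w)"
      have "?z \<in> rspace V j"
        using Suc eV gV subspace_add[OF V] by (auto simp: T_def)
      then have "?s j ?z \<in> T" unfolding T_def by blast
      then show ?case using Suc inj[of ?z] by auto
    qed
    then show False using n[OF j eV[OF w(1)]] by blast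
  qed
  ultimately show ?thesis
    using selfadjoint_nilpotent_or_bijective[OF indecomposable, of ?s] assms by blast
qed

text \<open>
  For a proper idempotent \<open>p\<close> of \<open>W = eV\<close>, the endomorphism \<open>e\<^sub>1 = p e\<close> and its adjoint \<open>g\<^sub>1\<close> satisfy
  all that has been shown for \<open>e\<close> and \<open>g\<close>. Write an element \<open>w \<in> W\<close> with \<open>p w \<noteq> w\<close> as
  \<open>e\<^sub>1 u + g\<^sub>1 u\<close>. Then \<open>g\<^sub>1 u = w - e\<^sub>1 u\<close> lies in \<open>eV\<close>, and in \<open>gV\<close> because \<open>e\<^sub>1 e = e\<^sub>1\<close> gives
  \<open>g g\<^sub>1 = g\<^sub>1\<close>. So it is \<open>0\<close>, and \<open>w = e\<^sub>1 u\<close> is fixed by \<open>p\<close> after all.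
\<close>
lemma image_indecomposable: "indecomposable_rep s Q (rep_image V e)"
proof (rule ccontr)
  let ?W = "rep_image V e"
  assume dec: "\<not> indecomposable_rep s Q ?W"
  interpret W: quiver_rep s Q ?W by unfold_locales (rule is_rep_image[OF endo])
  have "nonzero_rep Q ?W" using nonzero by (auto intro: nonzero_rep_imageI)
  then obtain p where p: "idempotent_endo s Q ?W p"
    and p0: "\<exists>i\<in>verts Q. \<exists>x\<in>rspace ?W i. p i x \<noteq> 0"
    and p1: "\<exists>i\<in>verts Q. \<exists>x\<in>rspace ?W i. p i x \<noteq> x"
    using W.idempotent_if_decomposable[OF _ dec] by blast
  have W_fix: "w \<in> rspace V i \<and> e i w = w" if "i \<in> verts Q" "w \<in> rspace ?W i" for i w
    using that closed idem by auto
  have p_endo: "rep_endo s Q ?W p" using p by (simp add: idempotent_endo_def)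
  note pW = rep_endoD(2)[OF p_endo]
  have eW: "e i x \<in> rspace ?W i" if "x \<in> rspace V i" for i x using that by simp
  have pp: "p i (p i w) = p i w" if "i \<in> verts Q" "w \<in> rspace ?W i" for i w
    using p that unfolding idempotent_endo_def by blast
  define e1 where "e1 i x = p i (e i x)" for i x
  have e1W: "e1 i x \<in> rspace ?W i" if "i \<in> verts Q" "x \<in> rspace V i" for i x
    using pW[OF that(1) eW[OF that(2)]] by (simp add: e1_def)
  have "rep_endo s Q V e1"
    unfolding rep_endo_def
  proof (intro conjI ballI)
    fix i assume i: "i \<in> verts Q"
    show "linear_map_on s s (rspace V i) (rspace V i) (e1 i)"
    proof (rule linear_map_onI)
      show "e1 i x \<in> rspace V i" if "x \<in> rspace V i" for x
        using W_fix[OF i e1W[OF i that]] by simp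
    qed (use linear_map_onD[OF rep_endoD(1)[OF endo i]] linear_map_onD[OF rep_endoD(1)[OF p_endo i]] eW
        in \<open>simp_all add: e1_def\<close>)
  next
    fix a x assume a: "a \<in> arcs Q" and x: "x \<in> rspace V (tail Q a)"
    show "e1 (head Q a) (rmap V a x) = rmap V a (e1 (tail Q a) x)"
      using rep_endoD(3)[OF p_endo a eW[OF x]] rep_endoD(3)[OF endo a x] by (simp add: e1_def)
  qed
  moreover have "e1 i (e1 i x) = e1 i x" if "i \<in> verts Q" "x \<in> rspace V i" for i x
    using W_fix[OF that(1) e1W[OF that]] pp[OF that(1) eW[OF that(2)]] by (simp add: e1_def)
  ultimately have e1: "idempotent_endo s Q V e1" by (simp add: idempotent_endo_def)
  then obtain g1 where g1: "rep_endo s Q V g1" "adjoint e1 g1"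
    using adjoint_exists by (metis idempotent_endo_def)
  have e1_eq: "e1 i w = p i w" if "i \<in> verts Q" "w \<in> rspace ?W i" for i w
    using W_fix[OF that] by (simp add: e1_def)
  interpret e1: proper_idempotent s S V J e1 g1
  proof unfold_locales
    show "\<exists>i\<in>verts Q. \<exists>x\<in>rspace V i. e1 i x \<noteq> 0" "\<exists>i\<in>verts Q. \<exists>x\<in>rspace V i. e1 i x \<noteq> x"
      using p0 p1 W_fix e1_eq by metis+
  qed (use indecomposable e1 g1 in auto)
  obtain i w where i: "i \<in> verts Q" and w: "w \<in> rspace ?W i" "p i w \<noteq> w" using p1 by blast
  note wV = W_fix[OF i w(1)]
  obtain u where u: "u \<in> rspace V i" "w = e1 i u + g1 i u"
    using e1.sum_bijective[OF i] wV by (auto simp: bij_betw_def)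
  let ?z = "g1 i u"
  have e1u: "e1 i u \<in> rspace V i" "e i (e1 i u) = e1 i u"
    using W_fix[OF i e1W[OF i u(1)]] by simp_all
  have zV: "?z \<in> rspace V i" using e1.adjoint_closed[OF i u(1)] .
  have "e i w = e1 i u + e i ?z"
    using linear_map_onD(2)[OF rep_endoD(1)[OF endo i] e1u(1) zV] e1u(2) u(2) by simp
  then have "e i ?z = ?z" using wV u(2) by simp
  moreover have "g i ?z = ?z"
  proof (rule J_eqI[OF i adjoint_closed[OF i zV] zV])
    fix y assume y: "y \<in> rspace V (vstar S i)"
    note i' = star_verts[OF i]
    have "e1 (vstar S i) (e (vstar S i) y) = e1 (vstar S i) y"
      using idem[OF i' y] by (simp add: e1_def)
    then show "J i (g i ?z) y = J i ?z y"
      using adjointD[OF adjoint i zV y] adjointD[OF g1(2) i u(1) closed[OF i' y]]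
        adjointD[OF g1(2) i u(1) y] by simp
  qed
  ultimately have "w = e1 i u" using images_disjoint[OF i zV] u(2) by simp
  then have "p i w = w" using pp[OF i eW[OF u(1)]] by (simp add: e1_def)
  then show False using w(2) by simp
qed

text \<open>
  The isomorphism sends \<open>u\<close> to \<open>e u\<close> and the functional \<open>\<langle>u, _\<rangle>\<close> restricted to \<open>W = eV\<close>. On \<open>W\<close>
  this functional equals \<open>\<langle>g u, _\<rangle>\<close> and determines \<open>g u\<close>, so the map is in essence
  \<open>u \<mapsto> (e u, g u)\<close>, which is bijective onto \<open>eV \<times> gV\<close> because \<open>V\<close> is their direct sum and
  \<open>e + g\<close> is bijective.
\<close>
lemma iso_image_sum_dual:
  "rep_iso s (module_prod.scale s dual_scale) Q V
    (rep_sum (rep_image V e) (dual_rep s S (rep_image V e)))"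
proof -
  let ?W = "rep_image V e"
  let ?f = "\<lambda>i u. (e i u, restricted_form e i u)"
  have eI: "y \<in> e i ` rspace V i \<Longrightarrow> y \<in> rspace V i \<and> e i y = y" if "i \<in> verts Q" for i y
    using that closed idem by auto
  have "rep_iso_map s (module_prod.scale s dual_scale) Q V (rep_sum ?W (dual_rep s S ?W)) ?f"
    unfolding rep_iso_map_def
  proof (intro conjI ballI)
    fix i assume i: "i \<in> verts Q"
    note i' = star_verts[OF i]
    show "linear_map_on s (module_prod.scale s dual_scale) (rspace V i)
        (rspace (rep_sum ?W (dual_rep s S ?W)) i) (?f i)"
      by (rule linear_map_onI)
        (use restricted_form_dual[OF endo i] restricted_form_linear[OF i] in
          \<open>simp_all add: rep_sum_def dual_rep_def module_prod_scale_apply[OF module_axioms module_dual_scale]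
            linear_map_onD[OF rep_endoD(1)[OF endo i]]\<close>)
    show "bij_betw (?f i) (rspace V i) (rspace (rep_sum ?W (dual_rep s S ?W)) i)"
      unfolding bij_betw_def
    proof (intro conjI inj_onI subset_antisym subsetI)
      fix u u' assume u: "u \<in> rspace V i" "u' \<in> rspace V i" and eq: "?f i u = ?f i u'"
      have "g i u = g i u'"
      proof (rule J_eqI[OF i adjoint_closed[OF i u(1)] adjoint_closed[OF i u(2)]])
        fix y assume y: "y \<in> rspace V (vstar S i)"
        have "J i u (e (vstar S i) y) = J i u' (e (vstar S i) y)"
        proof -
          have "restricted_form e i u (e (vstar S i) y) = restricted_form e i u' (e (vstar S i) y)"
            using eq by simp
          then show ?thesis using y by (simp add: restricted_form_def)
        qed
        then show "J i (g i u) y = J i (g i u') y"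
          using adjointD[OF adjoint i _ y] u by simp
      qed
      then have "e i u + g i u = e i u' + g i u'" using eq by simp
      then show "u = u'"
        using sum_bijective[OF i] u by (auto simp: bij_betw_def dest: inj_onD)
    next
      fix x\<gamma> assume "x\<gamma> \<in> rspace (rep_sum ?W (dual_rep s S ?W)) i"
      then obtain x \<gamma> where x: "x \<in> rspace V i" and x\<gamma>: "x\<gamma> = (e i x, \<gamma>)"
        and \<gamma>: "\<gamma> \<in> dual_space s (e (vstar S i) ` rspace V (vstar S i))"
        by (auto simp: rep_sum_def dual_rep_def)
      \<comment> \<open>\<open>y\<close> represents \<open>\<gamma> \<circ> e\<close>, so \<open>g y\<close> is the element of \<open>gV\<close> that pairs with \<open>W\<close> like \<open>\<gamma>\<close>.\<close>
      obtain y where y: "y \<in> rspace V i"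
        and Jy: "J i y = transpose_on (rspace V (vstar S i)) (e (vstar S i)) \<gamma>"
        using J_onto[OF i dual_space_transpose[OF linear_map_on_image[OF rep_endoD(1)[OF endo i']]
              subspace_rspace[OF i'] \<gamma>]] .
      note V = subspace_rspace[OF i]
      note eV = closed[OF i] and gV = adjoint_closed[OF i]
      have "e i x + g i y \<in> rspace V i" using subspace_add[OF V] eV[OF x] gV[OF y] by simp
      then have "e i x + g i y \<in> (\<lambda>u. e i u + g i u) ` rspace V i"
        using sum_bijective[OF i] by (simp add: bij_betw_def)
      then obtain u where u: "u \<in> rspace V i" "e i x + g i y = e i u + g i u" by blast
      let ?d = "e i u - e i x"
      have d: "?d = g i y - g i u" using u(2) by (simp add: algebra_simps)
      have "?d \<in> rspace V i" using subspace_diff[OF V eV[OF u(1)] eV[OF x]] .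
      moreover have "e i ?d = ?d"
        using linear_map_on_diff[OF rep_endoD(1)[OF endo i] V eV[OF u(1)] eV[OF x]] idem[OF i] u(1) x
        by simp
      moreover have "g i ?d = ?d"
        unfolding d
        using linear_map_on_diff[OF rep_endoD(1)[OF adjoint_endo i] V gV[OF y] gV[OF u(1)]]
          adjoint_idem[OF i] u(1) y by simp
      ultimately have d0: "?d = 0" by (rule images_disjoint[OF i])
      have eu: "e i u = e i x" using d0 by simp
      have gu: "g i u = g i y" using d0[unfolded d] by simp
      have "restricted_form e i u w = \<gamma> w" for w
      proof (cases "w \<in> e (vstar S i) ` rspace V (vstar S i)")
        case True
        have w: "w \<in> rspace V (vstar S i)" "e (vstar S i) w = w" using eI[OF i' True] by simp_all
        have "J i u w = J i (g i u) w" using adjointD[OF adjoint i u(1) w(1)] w(2) by simp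
        also have "\<dots> = J i y w" using adjointD[OF adjoint i y w(1)] w(2) gu by simp
        finally show ?thesis using True w Jy by (simp add: restricted_form_def transpose_on_def)
      next
        case False
        then show ?thesis using \<gamma> by (simp add: restricted_form_def dual_space_def)
      qed
      then have "?f i u = x\<gamma>" using eu x\<gamma> by auto
      then show "x\<gamma> \<in> ?f i ` rspace V i" using u(1) by blast
    qed (use restricted_form_dual[OF endo i] in \<open>auto simp: rep_sum_def dual_rep_def\<close>)
  next
    fix a u assume a: "a \<in> arcs Q" and u: "u \<in> rspace V (tail Q a)"
    show "?f (head Q a) (rmap V a u) = rmap (rep_sum ?W (dual_rep s S ?W)) a (?f (tail Q a) u)"
      using restricted_form_rmap[OF endo a u] rep_endoD(3)[OF endo a u] by (simp add: rep_sum_def)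
  qed
  then show ?thesis by (auto simp: rep_iso_def)
qed

end

theorem lemma4p5:
  fixes S :: "('a, 'b) signed_quiver"
    and scale :: "'k::{alg_closed_field, field_char_0} \<Rightarrow> 'v::ab_group_add \<Rightarrow> 'v"
    and V :: "('a cover, 'b cover, 'v) rep"
    and J :: "'a cover \<Rightarrow> 'v \<Rightarrow> 'v \<Rightarrow> 'k"
  assumes "signed_quiver S"
    and "vector_space scale"
    and "indecomposable_symmetric_rep scale S V J"
  shows "indecomposable_rep scale (symmetric_quiver S) V \<or>
    (\<exists>W :: ('a cover, 'b cover, 'v) rep.
      indecomposable_rep scale (symmetric_quiver S) W \<and>
      rep_iso scale (module_prod.scale scale dual_scale) (symmetric_quiver S)
        V (rep_sum W (dual_rep scale S W)))"
proof (cases "indecomposable_rep scale (symmetric_quiver S) V")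
  case True
  then show ?thesis by (rule disjI1)
next
  case dec: False
  have nz: "nonzero_rep (symmetric_quiver S) V" and sym: "symmetric_rep scale S V J"
    using assms(3) by (simp_all add: indecomposable_symmetric_rep_def)
  interpret symmetric_representation scale S V J
    using assms(1,2) sym by (simp add: symmetric_representation_def symmetric_representation_axioms_def)
  obtain e where e: "idempotent_endo scale Q V e"
    and nontrivial: "\<exists>i\<in>verts Q. \<exists>x\<in>rspace V i. e i x \<noteq> 0" "\<exists>i\<in>verts Q. \<exists>x\<in>rspace V i. e i x \<noteq> x"
    using idempotent_if_decomposable[OF nz dec] by blast
  obtain g where g: "rep_endo scale Q V g" "adjoint e g"
    using adjoint_exists e by (metis idempotent_endo_def)
  interpret proper_idempotent scale S V J e g
    by unfold_locales (use assms(3) e nontrivial g in auto)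
  show ?thesis
    using image_indecomposable iso_image_sum_dual by blast
qed

end
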